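(* Let $\alpha,\beta>-1$. For each $n$ let $\ell_1^{(n)},\dots,\ell_n^{(n)}$ be the Lagrange basis polynomials for the $n$ Jacobi-Gauss-Lobatto points, i.e. the $n$ roots of $(1-x^2)P_{n-2}^{(\alpha,\beta)}(x)$. Then $$\max_{1\le j\le n}\|\ell_j^{(n)}\|_\infty=\begin{cases} O\left(n^{-\min\{0,\alpha+\frac12,\beta+\frac12\}}\right),&-1<\alpha,\beta\le\frac32,\\ O\left(n^{-\min\{0,\alpha+\frac12,2+\alpha-\beta,\frac52-\beta\}}\right),&-1<\alpha\le\frac32,\ \beta>\frac32,\\ O\left(n^{-\min\{0,\beta+\frac12,2+\beta-\alpha,\frac52-\alpha\}}\right),&\alpha>\frac32,\ -1<\beta\le\frac32,\\ O\left(n^{-\min\{0,2+\alpha-\beta,2+\beta-\alpha,\frac52-\alpha,\frac52-\beta\}}\right),&\alpha,\beta>\frac32. \end{cases}$$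
   Context: $P_m^{(\alpha,\beta)}$ is the Jacobi polynomial of degree $m$ (orthogonal on $[-1,1]$ with respect to the weight $(1-t)^\alpha(1+t)^\beta$, normalized by $P_m^{(\alpha,\beta)}(1)=\binom{m+\alpha}{m}$); its $m$ roots are simple and lie in $(-1,1)$. For distinct nodes $x_1,\dots,x_n$ with $\omega_n(x)=\prod_i(x-x_i)$, the Lagrange basis polynomials are $\ell_k^{(n)}(x)=\frac{\omega_n(x)}{\omega_n'(x_k)(x-x_k)}$. $\|\cdot\|_\infty$ is the supremum norm on $[-1,1]$. The $O$-constants depend only on $\alpha,\beta$, and the asymptotics are as $n\to\infty$. *)

theory Defs
  imports
    "HOL-Analysis.Analysis"
    "HOL-Computational_Algebra.Polynomial"
    "HOL-Library.Landau_Symbols"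
begin

definition jacobi_inner :: "real \<Rightarrow> real \<Rightarrow> real poly \<Rightarrow> real poly \<Rightarrow> real" where
  "jacobi_inner \<alpha> \<beta> p q =
     integral {-1..1} (\<lambda>t. (1 - t) powr \<alpha> * (1 + t) powr \<beta> * poly p t * poly q t)"

definition is_jacobi_family :: "real \<Rightarrow> real \<Rightarrow> (nat \<Rightarrow> real poly) \<Rightarrow> bool" where
  "is_jacobi_family \<alpha> \<beta> P \<longleftrightarrow>
     (\<forall>m. degree (P m) = m) \<and>
     (\<forall>l m. l \<noteq> m \<longrightarrow> jacobi_inner \<alpha> \<beta> (P l) (P m) = 0) \<and>
     (\<forall>m. poly (P m) 1 = (real m + \<alpha>) gchoose m)"

(* For \<alpha>, \<beta> > -1 exactly one such family exists; otherwise the value is unspecified. *)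
definition jacobi_poly :: "real \<Rightarrow> real \<Rightarrow> nat \<Rightarrow> real poly" where
  "jacobi_poly \<alpha> \<beta> = (THE P. is_jacobi_family \<alpha> \<beta> P)"

(* The j-th smallest root of (1 - x^2) P_{n-2}(x), for 1 \<le> j \<le> n; meaningful for n \<ge> 2. *)
definition lobatto_node :: "real \<Rightarrow> real \<Rightarrow> nat \<Rightarrow> nat \<Rightarrow> real" where
  "lobatto_node \<alpha> \<beta> n j =
     sorted_list_of_set {x. (1 - x\<^sup>2) * poly (jacobi_poly \<alpha> \<beta> (n - 2)) x = 0} ! (j - 1)"

definition node_poly :: "(nat \<Rightarrow> real) \<Rightarrow> nat \<Rightarrow> real poly" where
  "node_poly x n = (\<Prod>i=1..n. [:- x i, 1:])"

(* The division by x - x_k is exact polynomial division, so the value at x_k is 1. *)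
definition lagrange_basis :: "(nat \<Rightarrow> real) \<Rightarrow> nat \<Rightarrow> nat \<Rightarrow> real poly" where
  "lagrange_basis x n k =
     smult (1 / poly (pderiv (node_poly x n)) (x k)) (node_poly x n div [:- x k, 1:])"

definition sup_norm :: "real poly \<Rightarrow> real" where
  "sup_norm p = (SUP t\<in>{-1..1}. \<bar>poly p t\<bar>)"

definition max_lobatto_norm :: "real \<Rightarrow> real \<Rightarrow> nat \<Rightarrow> real" where
  "max_lobatto_norm \<alpha> \<beta> n =
     Max ((\<lambda>j. sup_norm (lagrange_basis (lobatto_node \<alpha> \<beta> n) n j)) ` {1..n})"

end

theory Submission
  imports Defs
begin

text \<open>Everything follows from the differential equation
  \<open>(1 - x\<^sup>2) y'' + (\<beta> - \<alpha> - (\<alpha> + \<beta> + 2) x) y' + (N\<^sup>2 - \<rho>\<^sup>2) y = 0\<close> of \<open>y = P\<^sub>m\<close>, where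
  \<open>\<rho> = (\<alpha> + \<beta> + 1) / 2\<close> and \<open>N = m + \<rho>\<close>; no asymptotic formula for Jacobi polynomials is needed.
  In Liouville normal form the energy \<open>N\<^sup>2 u\<^sup>2 + u'\<^sup>2\<close> has logarithmic derivative
  \<open>O(1 / (N \<theta>\<^sup>2))\<close> at angular distance \<open>\<theta>\<close> from the endpoints, so on
  \<open>1 - x\<^sup>2 \<ge> const / N\<^sup>2\<close> it is constant up to a bounded factor. This bounds \<open>|y|\<close> from above there and
  \<open>|y'|\<close> from below at the roots, both in terms of the amplitude (the root of the energy at 0). In the
  remaining endpoint layers \<open>y\<close> is almost constant, which relates \<open>y(1)\<close> and \<open>y(-1)\<close> to the amplitude.
  In the quotient defining a Lagrange basis polynomial the amplitude cancels: close to the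
  node the mean value theorem gives a bounded quotient, and away from it the bounds are powers of the
  distances to \<open>1\<close> and \<open>-1\<close> (cut off at the layer width), whose maximum gives the exponents.\<close>

section \<open>Jacobi polynomials\<close>

text \<open>The O-constants may depend on \<alpha> and \<beta> only, while the equation carries
  \<open>N\<close> and \<open>y\<close>. The estimates therefore live in a locale that keeps of
  \<open>y\<close> nothing but the equation; its numerical constants involve only \<alpha> and
  \<beta>, and the resulting estimates are stated outside it, with the constant quantified before
  \<open>N\<close> and \<open>y\<close>. The reflection of x to -x exchanges \<alpha> and \<beta>
  within this class, so only the right half is estimated. Let \<open>l\<close> be the layer width,
  \<open>A\<close> and \<open>Z\<close> the cut-off distances of x and of the node z from 1,
  \<open>B\<close> that of x from -1, \<open>p = 3/4 - \<alpha> / 2\<close> and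
  \<open>q = 3/4 - \<beta> / 2\<close>. For \<open>z \<ge> 0\<close> and x away from z, the quotient
  is at most a constant times \<open>sqrt l * A powr p * B powr q * Z powr (1/2 - p) / \<bar>x -
  z\<bar>\<close>. Its extreme values, at distances of order \<open>l\<close> or 1, give linear
  lower bounds for a single exponent. The four cases of the theorem differ only in which of these
  bounds can decide the maximum.\<close>

lemma prod_linear_dvd:
  fixes p :: "'a::idom poly"
  assumes "finite R" and "\<And>r. r \<in> R \<Longrightarrow> poly p r = 0"
  shows "(\<Prod>r\<in>R. [:- r, 1:]) dvd p"
  using assms
proof (induction R)
  case (insert a R)
  then obtain g where g: "p = (\<Prod>r\<in>R. [:- r, 1:]) * g" by (auto elim: dvdE)
  moreover have "poly (\<Prod>r\<in>R. [:- r, 1:]) a \<noteq> 0" using insert.hyps by (simp add: poly_prod)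
  ultimately have "poly g a = 0" using insert.prems[of a] by simp
  then obtain h where "g = [:- a, 1:] * h" unfolding poly_eq_0_iff_dvd by (elim dvdE)
  then have "p = (\<Prod>r\<in>insert a R. [:- r, 1:]) * h"
    unfolding g prod.insert[OF insert.hyps] by (simp only: mult_ac)
  then show ?case by (rule dvdI)
qed simp

section \<open>Polynomial solutions of the Jacobi equation\<close>

locale jacobi_weight =
  fixes \<alpha> \<beta> :: real
  assumes alpha: "\<alpha> > -1" and beta: "\<beta> > -1"
begin

definition eigenvalue :: "nat \<Rightarrow> real" where
  "eigenvalue m = real m * (real m + \<alpha> + \<beta> + 1)"

definition is_eigenpoly :: "real \<Rightarrow> real poly \<Rightarrow> bool" where
  "is_eigenpoly l p \<longleftrightarrow> (\<forall>x. (1 - x\<^sup>2) * poly (pderiv (pderiv p)) x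
     + (\<beta> - \<alpha> - (\<alpha> + \<beta> + 2) * x) * poly (pderiv p) x + l * poly p x = 0)"

text \<open>Coefficients of the eigenpolynomial in powers of \<open>x - 1\<close>; they vanish beyond \<open>m\<close>.\<close>

fun taylor_coeff :: "nat \<Rightarrow> nat \<Rightarrow> real" where
  "taylor_coeff m 0 = (real m + \<alpha>) gchoose m"
| "taylor_coeff m (Suc k) = taylor_coeff m k *
     ((real m - real k) * (real m + real k + \<alpha> + \<beta> + 1) / (2 * (real k + 1) * (real k + 1 + \<alpha>)))"

definition taylor_poly :: "nat \<Rightarrow> real poly" where
  "taylor_poly m = (\<Sum>k\<le>m. monom (taylor_coeff m k) k)"

definition eigenpoly :: "nat \<Rightarrow> real poly" where
  "eigenpoly m = pcompose (taylor_poly m) [:-1, 1:]"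

lemma taylor_coeff_eq_0: "m < k \<Longrightarrow> taylor_coeff m k = 0"
  by (induction k) (auto simp: less_Suc_eq)

lemma coeff_taylor_poly: "coeff (taylor_poly m) k = taylor_coeff m k"
  by (auto simp: taylor_poly_def coeff_sum coeff_monom if_distrib sum.delta taylor_coeff_eq_0 not_le
      cong: if_cong)

lemma gchoose_pos: "(real m + \<alpha>) gchoose m > 0"
  unfolding gbinomial_pochhammer' using alpha by (auto intro!: divide_pos_pos pochhammer_pos)

lemma taylor_coeff_pos: "k \<le> m \<Longrightarrow> taylor_coeff m k > 0"
proof (induction k)
  case (Suc k)
  \<comment> \<open>\<open>\<alpha> + \<beta> + 1\<close> is only known to exceed \<open>-1\<close>;
    \<open>m + k \<ge> 1\<close> makes the factor containing it positive.\<close>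
  then have "real m + real k \<ge> 1" by linarith
  then show ?case using Suc alpha beta by (auto intro!: mult_pos_pos divide_pos_pos)
qed (simp add: gchoose_pos)

lemma degree_taylor_poly: "degree (taylor_poly m) = m"
proof (rule antisym)
  show "degree (taylor_poly m) \<le> m"
    by (rule degree_le) (simp add: coeff_taylor_poly taylor_coeff_eq_0)
  show "m \<le> degree (taylor_poly m)"
    using taylor_coeff_pos[of m m] by (intro le_degree) (simp add: coeff_taylor_poly)
qed

lemma degree_eigenpoly [simp]: "degree (eigenpoly m) = m"
  by (simp add: eigenpoly_def degree_pcompose degree_taylor_poly)

lemma eigenpoly_at_1: "poly (eigenpoly m) 1 = (real m + \<alpha>) gchoose m"
  by (simp add: eigenpoly_def poly_pcompose poly_0_coeff_0 coeff_taylor_poly)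

lemma eigenpoly_nonzero [simp]: "eigenpoly m \<noteq> 0"
  using eigenpoly_at_1[of m] gchoose_pos[of m] by auto

lemma taylor_coeff_rec:
  "(eigenvalue m - eigenvalue k) * taylor_coeff m k
     = 2 * (real k + 1) * (real k + 1 + \<alpha>) * taylor_coeff m (Suc k)"
proof -
  have "2 * (real k + 1) * (real k + 1 + \<alpha>) > 0" using alpha by (intro mult_pos_pos) auto
  have cancel: "d * (X * (n / d)) = n * X" if "d > 0" for d X n :: real using that by simp
  have "2 * (real k + 1) * (real k + 1 + \<alpha>) * taylor_coeff m (Suc k)
     = (real m - real k) * (real m + real k + \<alpha> + \<beta> + 1) * taylor_coeff m k"
    unfolding taylor_coeff.simps(2) by (rule cancel) fact
  then show ?thesis by (simp only: eigenvalue_def) (simp add: algebra_simps)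
qed

text \<open>In \<open>t = x - 1\<close> one has \<open>1 - x\<^sup>2 = - 2 t - t\<^sup>2\<close> and
  \<open>\<beta> - \<alpha> - (\<alpha> + \<beta> + 2) x = - 2 (\<alpha> + 1) - (\<alpha> + \<beta>
  + 2) t\<close>. Comparing coefficients gives exactly the recursion; \<open>k = 0\<close> and
  \<open>k = 1\<close> stand apart because the multipliers shift coefficients by up to two
  places.\<close>

lemma taylor_poly_ode:
  "[:0, -2, -1:] * pderiv (pderiv (taylor_poly m))
     + [:- 2 * (\<alpha> + 1), - (\<alpha> + \<beta> + 2):] * pderiv (taylor_poly m)
     + smult (eigenvalue m) (taylor_poly m) = 0"
proof (rule poly_eqI)
  fix k
  show "coeff ([:0, -2, -1:] * pderiv (pderiv (taylor_poly m))
     + [:- 2 * (\<alpha> + 1), - (\<alpha> + \<beta> + 2):] * pderiv (taylor_poly m)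
     + smult (eigenvalue m) (taylor_poly m)) k = coeff 0 k"
  proof (cases k)
    case 0
    then show ?thesis using taylor_coeff_rec[of m 0]
      by (simp add: coeff_pderiv coeff_taylor_poly eigenvalue_def algebra_simps del: taylor_coeff.simps)
  next
    case k: (Suc j)
    show ?thesis
    proof (cases j)
      case 0
      then show ?thesis using taylor_coeff_rec[of m 1] unfolding k
        by (simp add: coeff_pderiv coeff_taylor_poly eigenvalue_def algebra_simps del: taylor_coeff.simps)
    next
      case (Suc i)
      then show ?thesis using taylor_coeff_rec[of m k] unfolding k
        by (simp add: coeff_pderiv coeff_taylor_poly eigenvalue_def algebra_simps del: taylor_coeff.simps)
    qed
  qed
qed

lemma is_eigenpoly_eigenpoly: "is_eigenpoly (eigenvalue m) (eigenpoly m)"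
  unfolding is_eigenpoly_def
proof
  fix x :: real
  have *: "pderiv [:-1, 1::real:] = 1" by (simp add: pderiv_pCons one_pCons)
  have "poly ([:0, -2, -1:] * pderiv (pderiv (taylor_poly m))
     + [:- 2 * (\<alpha> + 1), - (\<alpha> + \<beta> + 2):] * pderiv (taylor_poly m)
     + smult (eigenvalue m) (taylor_poly m)) (x - 1) = 0"
    unfolding taylor_poly_ode by simp
  then show "(1 - x\<^sup>2) * poly (pderiv (pderiv (eigenpoly m))) x
     + (\<beta> - \<alpha> - (\<alpha> + \<beta> + 2) * x) * poly (pderiv (eigenpoly m)) x
     + eigenvalue m * poly (eigenpoly m) x = 0"
    unfolding eigenpoly_def pderiv_pcompose * mult_1_right
    by (simp add: poly_pcompose algebra_simps power2_eq_square)
qed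

section \<open>Orthogonality and uniqueness of the Jacobi family\<close>

abbreviation weight :: "real \<Rightarrow> real" where
  "weight t \<equiv> (1 - t) powr \<alpha> * (1 + t) powr \<beta>"

text \<open>The substitution \<open>x = 2 s - 1\<close> turns the weight into the Beta integrand
  with parameters \<open>\<beta> + 1\<close> and \<open>\<alpha> + 1\<close>, whose integrability
  covers the endpoint singularities of negative exponents.\<close>

lemma weight_integrable: "weight integrable_on {-1..1}"
proof -
  have "(\<lambda>t. t powr (\<beta> + 1 - 1) * (1 - t) powr (\<alpha> + 1 - 1)) integrable_on cbox 0 1"
    using has_integral_Beta_real[of "\<beta> + 1" "\<alpha> + 1"] alpha beta by (auto simp: integrable_on_def)
  from integrable_affinity[OF this, of "1/2" "1/2"]
  have "(\<lambda>x. (x / 2 + 1 / 2) powr \<beta> * (1 - (x / 2 + 1 / 2)) powr \<alpha>) integrable_on {-1..1}"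
    by (simp add: image_affinity_atLeastAtMost_diff)
  then have "(\<lambda>x. 2 powr \<alpha> * 2 powr \<beta> * ((x / 2 + 1 / 2) powr \<beta> * (1 - (x / 2 + 1 / 2)) powr \<alpha>)) integrable_on {-1..1}"
    by (rule integrable_on_mult_right)
  moreover have "2 powr \<alpha> * 2 powr \<beta> * ((x / 2 + 1 / 2) powr \<beta> * (1 - (x / 2 + 1 / 2)) powr \<alpha>) = weight x"
    if "x \<in> {-1..1}" for x
  proof -
    have "x / 2 + 1 / 2 = (1 + x) / 2" "1 - (x / 2 + 1 / 2) = (1 - x) / 2" by (auto simp: field_simps)
    then show ?thesis using that by (simp only:) (simp add: powr_divide)
  qed
  ultimately show ?thesis by (rule integrable_eq)
qed

lemma weight_poly_integrable: "(\<lambda>t. weight t * poly p t) integrable_on {-1..1}"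
proof -
  have w: "weight absolutely_integrable_on {-1..1}"
    using weight_integrable by (intro nonnegative_absolutely_integrable_1) auto
  have cont: "continuous_on {-1..1} (poly p)" by (intro continuous_intros)
  then have meas: "poly p \<in> borel_measurable (lebesgue_on {-1..1})"
    by (rule continuous_imp_measurable_on_sets_lebesgue) auto
  from cont have bnd: "bounded (poly p ` {-1..1})"
    by (intro compact_imp_bounded compact_continuous_image) auto
  have "(\<lambda>t. poly p t * weight t) absolutely_integrable_on {-1..1}"
    by (rule absolutely_integrable_bounded_measurable_product_real[OF meas _ bnd w]) simp
  then have "(\<lambda>t. poly p t * weight t) integrable_on {-1..1}"
    by (rule set_lebesgue_integral_eq_integral(1))
  then show ?thesis by (rule integrable_eq) (rule mult.commute)
qed

lemma jacobi_inner_altdef: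
  "jacobi_inner \<alpha> \<beta> p q = integral {-1..1} (\<lambda>t. weight t * poly (p * q) t)"
  unfolding jacobi_inner_def poly_mult by (simp only: mult.assoc)

lemma jacobi_inner_commute: "jacobi_inner \<alpha> \<beta> p q = jacobi_inner \<alpha> \<beta> q p"
  unfolding jacobi_inner_altdef by (simp only: mult.commute[of p q])

lemma jacobi_inner_diff_smult:
  "jacobi_inner \<alpha> \<beta> p (q - smult c r) = jacobi_inner \<alpha> \<beta> p q - c * jacobi_inner \<alpha> \<beta> p r"
proof -
  have "jacobi_inner \<alpha> \<beta> p (q - smult c r)
    = integral {-1..1} (\<lambda>t. weight t * poly (p * q) t - c * (weight t * poly (p * r) t))"
    unfolding jacobi_inner_altdef by (intro integral_cong) (simp add: algebra_simps)
  also have "\<dots> = jacobi_inner \<alpha> \<beta> p q - c * jacobi_inner \<alpha> \<beta> p r"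
    unfolding jacobi_inner_altdef
    by (simp only: integral_diff[OF weight_poly_integrable integrable_on_mult_right[OF weight_poly_integrable]]
        integral_mult_right)
  finally show ?thesis .
qed

text \<open>Self-adjointness: \<open>p' q - p q'\<close>, multiplied by the weight with both
  exponents raised by 1, has derivative \<open>k - l\<close> times weight times \<open>p q\<close>.
  It vanishes at both ends because the raised exponents are positive.\<close>

lemma eigenpoly_orthogonal:
  assumes p: "is_eigenpoly l p" and q: "is_eigenpoly k q" and "l \<noteq> k"
  shows "jacobi_inner \<alpha> \<beta> p q = 0"
proof -
  define F where "F t = (1 - t) powr (\<alpha> + 1) * (1 + t) powr (\<beta> + 1)
      * (poly (pderiv p) t * poly q t - poly p t * poly (pderiv q) t)" for t
  have "((\<lambda>t. weight t * poly (p * q) t * (k - l)) has_integral (F 1 - F (-1))) {-1..1}"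
  \<comment> \<open>For a negative exponent the weight is unbounded near an endpoint, where
    \<open>F\<close> need only be continuous.\<close>
  proof (rule fundamental_theorem_of_calculus_interior)
    show "continuous_on {-1..1} F" unfolding F_def
      using alpha beta by (intro continuous_intros continuous_on_powr') auto
    fix x :: real assume x: "x \<in> {-1<..<1}"
    define P0 P1 P2 Q0 Q1 Q2 where defs: "P0 = poly p x" "P1 = poly (pderiv p) x" "P2 = poly (pderiv (pderiv p)) x"
      "Q0 = poly q x" "Q1 = poly (pderiv q) x" "Q2 = poly (pderiv (pderiv q)) x"
    have ode: "(1 - x\<^sup>2) * P2 = - (\<beta> - \<alpha> - (\<alpha> + \<beta> + 2) * x) * P1 - l * P0"
      "(1 - x\<^sup>2) * Q2 = - (\<beta> - \<alpha> - (\<alpha> + \<beta> + 2) * x) * Q1 - k * Q0"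
      using p q unfolding is_eigenpoly_def defs by (simp_all add: algebra_simps)
    have "(F has_real_derivative
        ((\<alpha> + 1) * (1 - x) powr \<alpha> * (- 1) * (1 + x) powr (\<beta> + 1)
         + (1 - x) powr (\<alpha> + 1) * ((\<beta> + 1) * (1 + x) powr \<beta>)) * (P1 * Q0 - P0 * Q1)
        + (1 - x) powr (\<alpha> + 1) * (1 + x) powr (\<beta> + 1) * (P2 * Q0 - P0 * Q2)) (at x)"
      unfolding F_def[abs_def] defs using x
      by (auto intro!: derivative_eq_intros simp: algebra_simps)
    also have "((\<alpha> + 1) * (1 - x) powr \<alpha> * (- 1) * (1 + x) powr (\<beta> + 1)
         + (1 - x) powr (\<alpha> + 1) * ((\<beta> + 1) * (1 + x) powr \<beta>)) * (P1 * Q0 - P0 * Q1)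
        + (1 - x) powr (\<alpha> + 1) * (1 + x) powr (\<beta> + 1) * (P2 * Q0 - P0 * Q2)
      = weight x * ((- (\<alpha> + 1) * (1 + x) + (\<beta> + 1) * (1 - x)) * (P1 * Q0 - P0 * Q1)
        + (((1 - x\<^sup>2) * P2) * Q0 - P0 * ((1 - x\<^sup>2) * Q2)))"
      using x by (simp add: powr_add power2_eq_square) (simp add: algebra_simps)
    also have "\<dots> = weight x * poly (p * q) x * (k - l)"
      unfolding ode by (simp add: defs algebra_simps)
    finally show "(F has_vector_derivative weight x * poly (p * q) x * (k - l)) (at x)"
      by (simp add: has_real_derivative_iff_has_vector_derivative)
  qed auto
  then have "((\<lambda>t. (k - l) * (weight t * poly (p * q) t)) has_integral 0) {-1..1}"
    using alpha beta by (simp add: F_def mult_ac)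
  from has_integral_mult_right[OF this, of "1 / (k - l)"]
  have "((\<lambda>t. weight t * poly (p * q) t) has_integral 0) {-1..1}"
    using \<open>l \<noteq> k\<close> by simp
  then show ?thesis unfolding jacobi_inner_altdef by (rule integral_unique)
qed

lemma eigenvalue_inj: "eigenvalue l = eigenvalue m \<Longrightarrow> l = m"
proof (rule ccontr)
  assume *: "eigenvalue l = eigenvalue m" "l \<noteq> m"
  have "eigenvalue l - eigenvalue m = (real l - real m) * (real l + real m + \<alpha> + \<beta> + 1)"
    by (simp add: eigenvalue_def algebra_simps)
  moreover have "real l + real m \<ge> 1" using \<open>l \<noteq> m\<close> by linarith
  then have "real l + real m + \<alpha> + \<beta> + 1 > 0" using alpha beta by linarith
  ultimately show False using * by simp
qed

lemma is_jacobi_family_eigenpoly: "is_jacobi_family \<alpha> \<beta> eigenpoly"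
  unfolding is_jacobi_family_def
  using eigenpoly_orthogonal[OF is_eigenpoly_eigenpoly is_eigenpoly_eigenpoly] eigenvalue_inj
  by (auto simp: eigenpoly_at_1)

text \<open>Multiples of the eigenpolynomials remove the leading coefficients one at a time. The
  assumption is on coefficients rather than on the degree, so that \<open>m = 0\<close> means
  \<open>r = 0\<close>.\<close>

lemma jacobi_inner_lower_degree:
  assumes "\<And>j. j < m \<Longrightarrow> jacobi_inner \<alpha> \<beta> p (eigenpoly j) = 0"
    and "\<And>i. i \<ge> m \<Longrightarrow> coeff r i = 0"
  shows "jacobi_inner \<alpha> \<beta> p r = 0"
  using assms
proof (induction m arbitrary: r)
  case 0
  then have "r = 0" by (intro poly_eqI) simp
  then show ?case by (simp add: jacobi_inner_altdef)
next
  case (Suc m)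
  define c where "c = coeff r m / coeff (eigenpoly m) m"
  have lead: "coeff (eigenpoly m) m \<noteq> 0"
    using leading_coeff_neq_0[OF eigenpoly_nonzero[of m]] by simp
  have "jacobi_inner \<alpha> \<beta> p (r - smult c (eigenpoly m)) = 0"
  proof (rule Suc.IH)
    fix i assume "m \<le> i"
    then consider "i = m" | "Suc m \<le> i" by linarith
    then show "coeff (r - smult c (eigenpoly m)) i = 0"
      using Suc.prems(2)[of i] lead by cases (auto simp: c_def coeff_eq_0)
  qed (use Suc.prems(1) in auto)
  then show ?case using Suc.prems(1)[of m] by (simp add: jacobi_inner_diff_smult)
qed

text \<open>On \<open>{-1/2..1/2}\<close> the weight is continuous and positive, so \<open>f\<close>
  vanishes on that interval and has infinitely many roots.\<close>

lemma weighted_integral_eq_0_imp: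
  assumes nonneg: "\<And>x. -1 < x \<Longrightarrow> x < 1 \<Longrightarrow> 0 \<le> poly f x"
    and zero: "integral {-1..1} (\<lambda>t. weight t * poly f t) = 0"
  shows "f = 0"
proof -
  have nn: "0 \<le> weight t * poly f t" if "t \<in> {-1..1}" for t
    \<comment> \<open>At the endpoints \<open>0 powr a = 0\<close> by convention, so the weight is 0
      there whatever the exponents are.\<close>
    using nonneg[of t] that by (cases "t = 1 \<or> t = -1") auto
  have cont: "continuous_on {-1/2..1/2} (\<lambda>t. weight t * poly f t)"
    by (intro continuous_intros) auto
  then have int: "(\<lambda>t. weight t * poly f t) integrable_on {-1/2..1/2}"
    by (rule integrable_continuous_real)
  have "integral {-1/2..1/2} (\<lambda>t. weight t * poly f t) \<le> integral {-1..1} (\<lambda>t. weight t * poly f t)"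
    by (rule integral_subset_le[OF _ int weight_poly_integrable]) (use nn in auto)
  moreover have "0 \<le> integral {-1/2..1/2} (\<lambda>t. weight t * poly f t)"
    by (rule integral_nonneg[OF int]) (use nn in auto)
  ultimately have hi: "((\<lambda>t. weight t * poly f t) has_integral 0) (cbox (-1/2) (1/2))"
    using int zero by (simp add: has_integral_integral)
  have "poly f x = 0" if "x \<in> {-1/2..1/2}" for x
  proof -
    have "weight x * poly f x = 0"
      by (rule has_integral_0_cbox_imp_0[OF _ _ hi]) (use cont nn that in auto)
    then show ?thesis using that by auto
  qed
  then have "{-1/2..1/2} \<subseteq> {x. poly f x = 0}" by auto
  moreover have "infinite {-1/2..1/2::real}" by simp
  ultimately show ?thesis using poly_roots_finite finite_subset by blast
qed

lemma jacobi_inner_self_eq_0: "jacobi_inner \<alpha> \<beta> p p = 0 \<Longrightarrow> p = 0"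
  using weighted_integral_eq_0_imp[of "p * p"] by (simp add: jacobi_inner_altdef)

text \<open>Strong induction: \<open>Q m\<close> and \<open>eigenpoly m\<close> are both orthogonal
  to all polynomials of lower degree, hence so is the combination \<open>r\<close> in which the
  leading terms cancel. As \<open>r\<close> itself has lower degree, it is orthogonal to itself; the
  value at 1 then fixes the factor.\<close>

lemma jacobi_family_unique:
  assumes "is_jacobi_family \<alpha> \<beta> Q"
  shows "Q = eigenpoly"
proof
  fix m show "Q m = eigenpoly m"
  proof (induction m rule: less_induct)
    case (less m)
    have Q: "degree (Q m) = m" "poly (Q m) 1 = (real m + \<alpha>) gchoose m"
      "l \<noteq> m \<Longrightarrow> jacobi_inner \<alpha> \<beta> (Q m) (Q l) = 0" for l
      using assms by (auto simp: is_jacobi_family_def)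
    define c where "c = coeff (Q m) m / coeff (eigenpoly m) m"
    define r where "r = Q m - smult c (eigenpoly m)"
    have lead: "coeff (eigenpoly m) m \<noteq> 0"
      using leading_coeff_neq_0[OF eigenpoly_nonzero[of m]] by simp
    have r: "coeff r i = 0" if "i \<ge> m" for i
      using that lead Q(1) by (cases "i = m") (auto simp: r_def c_def coeff_eq_0)
    have 1: "jacobi_inner \<alpha> \<beta> (Q m) r = 0"
      by (rule jacobi_inner_lower_degree[where m = m and r = r, OF _ r]) (use less Q(3) in force)
    have 2: "jacobi_inner \<alpha> \<beta> (eigenpoly m) r = 0"
      by (rule jacobi_inner_lower_degree[where m = m and r = r, OF _ r])
        (use is_jacobi_family_eigenpoly in \<open>auto simp: is_jacobi_family_def\<close>)
    have "jacobi_inner \<alpha> \<beta> r (Q m - smult c (eigenpoly m)) = 0"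
      unfolding jacobi_inner_diff_smult jacobi_inner_commute[of r "Q m"]
        jacobi_inner_commute[of r "eigenpoly m"] 1 2 by simp
    then have "r = 0"
      unfolding r_def[symmetric] by (rule jacobi_inner_self_eq_0)
    then have "Q m = smult c (eigenpoly m)"
      by (simp add: r_def)
    moreover from this have "c = 1"
      using Q(2) gchoose_pos[of m] by (simp add: eigenpoly_at_1)
    ultimately show ?case by simp
  qed
qed

lemma jacobi_poly_eq: "jacobi_poly \<alpha> \<beta> = eigenpoly"
  unfolding jacobi_poly_def
  using is_jacobi_family_eigenpoly jacobi_family_unique by (rule the_equality)

text \<open>With fewer than \<open>m\<close> roots the product of \<open>p\<close> with \<open>\<Prod>(x - r)\<close> over its roots would have constant sign,
  contradicting orthogonality to lower degrees.\<close>

lemma card_roots_eigenpoly: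
  assumes simple: "\<And>x. -1 < x \<Longrightarrow> x < 1 \<Longrightarrow> poly (eigenpoly m) x = 0 \<Longrightarrow> poly (pderiv (eigenpoly m)) x \<noteq> 0"
  defines "R \<equiv> {x. -1 < x \<and> x < 1 \<and> poly (eigenpoly m) x = 0}"
  shows "\<exists>c. eigenpoly m = smult c (\<Prod>r\<in>R. [:- r, 1:])" and "card R = m" and "finite R"
proof -
  define q where "q = (\<Prod>r\<in>R. [:- r, 1::real:])"
  show fin: "finite R"
    using poly_roots_finite[OF eigenpoly_nonzero[of m]] by (rule finite_subset[rotated]) (auto simp: R_def)
  have deg_q: "degree q = card R"
    unfolding q_def by (subst degree_prod_eq_sum_degree) auto
  have roots_q: "poly q x = 0 \<longleftrightarrow> x \<in> R" for x
    using fin by (auto simp: q_def poly_prod)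
  obtain g where g: "eigenpoly m = q * g"
    using prod_linear_dvd[OF fin, of "eigenpoly m"] by (auto simp: R_def q_def elim: dvdE)
  then have nz: "q \<noteq> 0" "g \<noteq> 0" using eigenpoly_nonzero[of m] by auto
  \<comment> \<open>A zero of \<open>g\<close> in the open interval would be a zero of
    \<open>q\<close> as well, hence a double zero of the eigenpolynomial.\<close>
  have g_nz: "poly g x \<noteq> 0" if x: "-1 < x" "x < 1" for x
  proof
    assume "poly g x = 0"
    moreover from this have "poly q x = 0" using x g roots_q by (auto simp: R_def)
    ultimately show False using simple[OF x] g by (simp add: pderiv_mult)
  qed
  have g_sign: "0 \<le> poly g x * poly g z" if "-1 < x" "x < 1" "-1 < z" "z < 1" for x z
  proof (rule ccontr)
    assume "\<not> 0 \<le> poly g x * poly g z"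
    then have *: "poly g x * poly g z < 0" "poly g z * poly g x < 0" by (auto simp: mult.commute)
    then have "x < z \<or> z < x" by (cases x z rule: linorder_cases) auto
    then show False
      using poly_IVT[OF _ *(1)] poly_IVT[OF _ *(2)] that g_nz
      by (meson less_trans)
  qed
  have "\<not> card R < m"
  proof
    assume "card R < m"
    have "jacobi_inner \<alpha> \<beta> (eigenpoly m) q = 0"
    proof (rule jacobi_inner_lower_degree[where m = m])
      show "jacobi_inner \<alpha> \<beta> (eigenpoly m) (eigenpoly j) = 0" if "j < m" for j
        using is_jacobi_family_eigenpoly that by (simp add: is_jacobi_family_def)
      show "coeff q i = 0" if "m \<le> i" for i
        using that deg_q \<open>card R < m\<close> by (intro coeff_eq_0) simp
    qed
    \<comment> \<open>The constant factor \<open>poly g 0\<close> makes the integrand nonnegative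
      whichever sign \<open>g\<close> has.\<close>
    then have "poly g 0 * integral {-1..1} (\<lambda>t. weight t * poly (q * g * q) t) = 0"
      unfolding jacobi_inner_altdef g by simp
    then have "integral {-1..1} (\<lambda>t. poly g 0 * (weight t * poly (q * g * q) t)) = 0"
      unfolding integral_mult_right .
    also have "(\<lambda>t. poly g 0 * (weight t * poly (q * g * q) t))
        = (\<lambda>t. weight t * poly (smult (poly g 0) (q * q * g)) t)"
      by (rule ext) (simp only: poly_mult poly_smult mult_ac)
    finally have "integral {-1..1} (\<lambda>t. weight t * poly (smult (poly g 0) (q * q * g)) t) = 0" .
    moreover have "0 \<le> poly (smult (poly g 0) (q * q * g)) x" if "-1 < x" "x < 1" for x
    proof -
      have "0 \<le> (poly q x)\<^sup>2 * (poly g 0 * poly g x)" using g_sign that by simp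
      then show ?thesis by (simp only: poly_mult poly_smult power2_eq_square mult_ac)
    qed
    ultimately have "smult (poly g 0) (q * q * g) = 0" by (rule weighted_integral_eq_0_imp[rotated])
    then show False using nz g_nz[of 0] by simp
  qed
  moreover have sum: "m = card R + degree g"
    using degree_mult_eq[OF nz] deg_q g by (metis degree_eigenpoly)
  ultimately show "card R = m" by simp
  with sum have "degree g = 0" by simp
  then obtain c where c: "g = [:c:]" using degree_eq_zeroE by blast
  then show "\<exists>c. eigenpoly m = smult c (\<Prod>r\<in>R. [:- r, 1:])"
    using g by (auto simp: q_def)
qed

end

section \<open>Energy estimates\<close>

text \<open>The bound makes \<open>f * exp (- k * T)\<close> nonincreasing and
  \<open>f * exp (k * T)\<close> nondecreasing, which gives the two directions.\<close>

lemma gronwall_comparison: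
  fixes f f' T T' :: "real \<Rightarrow> real"
  assumes "a \<le> b"
    and df: "\<And>x. a \<le> x \<Longrightarrow> x \<le> b \<Longrightarrow> (f has_real_derivative f' x) (at x)"
    and dT: "\<And>x. a \<le> x \<Longrightarrow> x \<le> b \<Longrightarrow> (T has_real_derivative T' x) (at x)"
    and bound: "\<And>x. a \<le> x \<Longrightarrow> x \<le> b \<Longrightarrow> \<bar>f' x\<bar> \<le> k * T' x * f x"
  shows "f b \<le> f a * exp (k * (T b - T a))" and "f a \<le> f b * exp (k * (T b - T a))"
proof -
  have "f b * exp (- k * T b) \<le> f a * exp (- k * T a)"
  proof (rule DERIV_nonpos_imp_nonincreasing[OF \<open>a \<le> b\<close>])
    fix x assume x: "a \<le> x" "x \<le> b"
    have "((\<lambda>x. f x * exp (- k * T x)) has_real_derivative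
        (f' x - k * T' x * f x) * exp (- k * T x)) (at x)"
      by (rule derivative_eq_intros df[OF x] dT[OF x] refl | simp add: algebra_simps)+
    moreover have "(f' x - k * T' x * f x) * exp (- k * T x) \<le> 0"
      using bound[OF x] by (intro mult_nonpos_nonneg) auto
    ultimately show "\<exists>y. ((\<lambda>x. f x * exp (- k * T x)) has_real_derivative y) (at x) \<and> y \<le> 0"
      by blast
  qed
  then have "f b * exp (- k * T b) * exp (k * T b) \<le> f a * exp (- k * T a) * exp (k * T b)"
    by (intro mult_right_mono) auto
  then show "f b \<le> f a * exp (k * (T b - T a))"
    by (simp add: mult.assoc flip: exp_add) (simp add: algebra_simps)
  have "f a * exp (k * T a) \<le> f b * exp (k * T b)"
  proof (rule DERIV_nonneg_imp_nondecreasing[OF \<open>a \<le> b\<close>])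
    fix x assume x: "a \<le> x" "x \<le> b"
    have "((\<lambda>x. f x * exp (k * T x)) has_real_derivative
        (f' x + k * T' x * f x) * exp (k * T x)) (at x)"
      by (rule derivative_eq_intros df[OF x] dT[OF x] refl | simp add: algebra_simps)+
    moreover have "(f' x + k * T' x * f x) * exp (k * T x) \<ge> 0"
      using bound[OF x] by (intro mult_nonneg_nonneg) auto
    ultimately show "\<exists>y. ((\<lambda>x. f x * exp (k * T x)) has_real_derivative y) (at x) \<and> 0 \<le> y"
      by blast
  qed
  then have "f a * exp (k * T a) * exp (- k * T a) \<le> f b * exp (k * T b) * exp (- k * T a)"
    by (intro mult_right_mono) auto
  then show "f a \<le> f b * exp (k * (T b - T a))"
    by (simp add: mult.assoc flip: exp_add) (simp add: algebra_simps)
qed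

lemma powr_has_derivative:
  fixes t :: "real \<Rightarrow> real"
  assumes "(t has_real_derivative t') (at x)" and "t x > 0"
  shows "((\<lambda>x. t x powr c) has_real_derivative c * (t x powr c / t x) * t') (at x)"
  using assms by (auto intro!: derivative_eq_intros simp: powr_diff)

text \<open>The algebra of \<open>energy_deriv\<close> with \<open>n = N\<^sup>2\<close>,
  \<open>r = \<rho>\<close>, \<open>D = 1 - x\<^sup>2\<close>, after the derivatives of
  \<open>y\<close> have been eliminated through the flux and the equation. Every term containing
  \<open>n\<close> cancels; this is what makes the logarithmic derivative of the energy as small as
  \<open>1 / N\<close>.\<close>

lemma energy_deriv_identity:
  fixes D :: real
  assumes "D \<noteq> 0"
  shows "w * q / D * (n * y0\<^sup>2 + v\<^sup>2 / D)
      + w * (n * (2 * y0 * ((v - q / 2 * y0) / D))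
      + (2 * v * (- (q / 2 + x) * ((v - q / 2 * y0) / D) - (n - r\<^sup>2 + r) * y0) * D + v\<^sup>2 * (2 * x)) / D\<^sup>2)
    = 2 * w * v * y0 / D * (r\<^sup>2 - r + (q / 2 + x) * q / (2 * D))"
  using assms apply (simp add: divide_simps)
  apply (simp add: power2_eq_square)
  apply (simp add: algebra_simps)
  done

text \<open>\<open>N \<ge> 1/2\<close> holds for \<open>N = m + \<rho>\<close> with
  \<open>m \<ge> 1\<close> because \<open>\<rho> > -1/2\<close>; \<open>eigenvalue_nonneg\<close>
  says that the coefficient of \<open>y\<close> in the equation is nonnegative.\<close>

locale jacobi_ode =
  fixes \<alpha> \<beta> N :: real and y :: "real poly"
  assumes alpha: "\<alpha> > -1" and beta: "\<beta> > -1"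
    and N_ge: "N \<ge> 1/2"
    and eigenvalue_nonneg: "((\<alpha> + \<beta> + 1) / 2)\<^sup>2 \<le> N\<^sup>2"
    and ode: "(1 - x\<^sup>2) * poly (pderiv (pderiv y)) x + (\<beta> - \<alpha> - (\<alpha> + \<beta> + 2) * x) * poly (pderiv y) x
              + (N\<^sup>2 - ((\<alpha> + \<beta> + 1) / 2)\<^sup>2) * poly y x = 0"
begin

definition wt :: "real \<Rightarrow> real" where
  "wt x = (1 - x) powr (\<alpha> + 1/2) * (1 + x) powr (\<beta> + 1/2)"

text \<open>With \<open>x = cos \<theta>\<close> and \<open>u = sqrt (wt x) * y\<close>, the flux is such that
  \<open>du/d\<theta> = - sqrt (wt x) * flux x / sqrt (1 - x\<^sup>2)\<close>; hence \<open>energy = N\<^sup>2 u\<^sup>2 + (du/d\<theta>)\<^sup>2\<close>.\<close>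

definition flux :: "real \<Rightarrow> real" where
  "flux x = (1 - x\<^sup>2) * poly (pderiv y) x + (\<beta> - \<alpha> - (\<alpha> + \<beta> + 1) * x) / 2 * poly y x"

definition energy :: "real \<Rightarrow> real" where
  "energy x = wt x * (N\<^sup>2 * (poly y x)\<^sup>2 + (flux x)\<^sup>2 / (1 - x\<^sup>2))"

lemma one_minus_square_pos: "-1 < x \<Longrightarrow> x < 1 \<Longrightarrow> 0 < 1 - (x::real)\<^sup>2"
  by (simp add: abs_square_less_1)

lemma wt_pos: "-1 < x \<Longrightarrow> x < 1 \<Longrightarrow> 0 < wt x"
  by (simp add: wt_def)

lemma wt_deriv:
  assumes x: "-1 < x" "x < 1"
  shows "(wt has_real_derivative wt x * (\<beta> - \<alpha> - (\<alpha> + \<beta> + 1) * x) / (1 - x\<^sup>2)) (at x)"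
proof -
  have d1: "((\<lambda>x. (1 - x) powr (\<alpha> + 1/2)) has_real_derivative
      (\<alpha> + 1/2) * ((1 - x) powr (\<alpha> + 1/2) / (1 - x)) * (- 1)) (at x)"
    using x by (intro powr_has_derivative) (auto intro!: derivative_eq_intros)
  have d2: "((\<lambda>x. (1 + x) powr (\<beta> + 1/2)) has_real_derivative
      (\<beta> + 1/2) * ((1 + x) powr (\<beta> + 1/2) / (1 + x)) * 1) (at x)"
    using x by (intro powr_has_derivative) (auto intro!: derivative_eq_intros)
  have e: "1 - x\<^sup>2 = (1 - x) * (1 + x)" by (simp add: power2_eq_square algebra_simps)
  have n: "1 - x \<noteq> 0" "1 + x \<noteq> 0" using x by auto
  have "(\<alpha> + 1/2) * (p / (1 - x)) * (- 1) * r + (\<beta> + 1/2) * (r / (1 + x)) * 1 * p =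
     p * r * (\<beta> - \<alpha> - (\<alpha> + \<beta> + 1) * x) / (1 - x\<^sup>2)" for p r
    unfolding e using n by (simp add: divide_simps) (simp add: algebra_simps)
  from DERIV_cong[OF DERIV_mult[OF d1 d2] this] show ?thesis
    unfolding wt_def[abs_def] .
qed

lemma energy_deriv:
  assumes x: "-1 < x" "x < 1"
  defines "q \<equiv> \<beta> - \<alpha> - (\<alpha> + \<beta> + 1) * x" and "\<rho> \<equiv> (\<alpha> + \<beta> + 1) / 2"
  shows "(energy has_real_derivative
     2 * wt x * flux x * poly y x / (1 - x\<^sup>2) * (\<rho>\<^sup>2 - \<rho> + (q / 2 + x) * q / (2 * (1 - x\<^sup>2)))) (at x)"
proof -
  define y0 y1 y2 v w D where defs: "y0 = poly y x" "y1 = poly (pderiv y) x"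
    "y2 = poly (pderiv (pderiv y)) x" "v = flux x" "w = wt x" "D = 1 - x\<^sup>2"
  have D: "D \<noteq> 0" using one_minus_square_pos[OF x] by (simp add: defs)
  define v' where "v' = D * y2 - 2 * x * y1 + q / 2 * y1 - \<rho> * y0"
  have dv: "(flux has_real_derivative v') (at x)"
    unfolding flux_def v'_def defs q_def \<rho>_def
    by (rule derivative_eq_intros poly_DERIV refl | simp add: field_simps)+
  have v': "v' = - (q / 2 + x) * y1 - (N\<^sup>2 - \<rho>\<^sup>2 + \<rho>) * y0"
    using ode[of x] unfolding v'_def defs q_def \<rho>_def by (simp add: algebra_simps)
  have y1: "y1 = (v - q / 2 * y0) / D"
    using D unfolding defs flux_def q_def by (simp add: field_simps)
  have "(energy has_real_derivative
     w * q / D * (N\<^sup>2 * y0\<^sup>2 + v\<^sup>2 / D) + w * (N\<^sup>2 * (2 * y0 * y1) + (2 * v * v' * D + v\<^sup>2 * (2 * x)) / D\<^sup>2)) (at x)"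
  proof -

    have "((\<lambda>x. N\<^sup>2 * (poly y x)\<^sup>2 + (flux x)\<^sup>2 / (1 - x\<^sup>2)) has_real_derivative
       (N\<^sup>2 * (2 * y0 * y1) + (2 * v * v' * D + v\<^sup>2 * (2 * x)) / D\<^sup>2)) (at x)"
      using D unfolding defs
      by (auto intro!: derivative_eq_intros dv simp: power2_eq_square algebra_simps defs)
    from DERIV_cong[OF DERIV_mult[OF wt_deriv[OF x] this]] show ?thesis
      unfolding energy_def[abs_def] by (simp add: defs q_def mult.commute[of _ "wt x"])
  qed
  also have "w * q / D * (N\<^sup>2 * y0\<^sup>2 + v\<^sup>2 / D) + w * (N\<^sup>2 * (2 * y0 * y1) + (2 * v * v' * D + v\<^sup>2 * (2 * x)) / D\<^sup>2)
     = 2 * w * v * y0 / D * (\<rho>\<^sup>2 - \<rho> + (q / 2 + x) * q / (2 * D))"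
    unfolding v' y1 by (rule energy_deriv_identity[OF D])
  finally show ?thesis by (simp add: defs)
qed

text \<open>An upper bound for \<open>\<bar>(\<rho>\<^sup>2 - \<rho>) * D + (q / 2 + x) * q /
  2\<bar>\<close>, that is, for the last factor of the energy derivative multiplied by
  \<open>D = 1 - x\<^sup>2\<close>.\<close>

definition growth :: real where
  "growth = \<bar>((\<alpha> + \<beta> + 1) / 2)\<^sup>2 - (\<alpha> + \<beta> + 1) / 2\<bar>
     + ((\<bar>\<beta> - \<alpha>\<bar> + \<bar>\<alpha> + \<beta> + 1\<bar>) / 2 + 1) * (\<bar>\<beta> - \<alpha>\<bar> + \<bar>\<alpha> + \<beta> + 1\<bar>) / 2"

lemma N_pos: "N > 0" using N_ge by simp

lemma energy_nonneg: "-1 < x \<Longrightarrow> x < 1 \<Longrightarrow> 0 \<le> energy x"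
  using wt_pos[of x] one_minus_square_pos[of x] by (simp add: energy_def)

lemma linear_coeff_bound:
  assumes "\<bar>x\<bar> \<le> 1"
  shows "\<bar>\<beta> - \<alpha> - (\<alpha> + \<beta> + 1) * x\<bar> \<le> \<bar>\<beta> - \<alpha>\<bar> + \<bar>\<alpha> + \<beta> + 1\<bar>"
proof -
  have "\<bar>(\<alpha> + \<beta> + 1) * x\<bar> \<le> \<bar>\<alpha> + \<beta> + 1\<bar>"
    using assms by (simp add: abs_mult mult_left_le)
  then show ?thesis by linarith
qed

text \<open>By the inequality between arithmetic and geometric mean,
  \<open>wt x * 2 N \<bar>y\<bar> \<bar>flux\<bar> / sqrt D\<close> is at most the energy. This
  yields the factor \<open>1 / (N * sqrt D)\<close>; the bracket contributes
  \<open>growth / D\<close>.\<close>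

lemma energy_deriv_bound:
  assumes x: "-1 < x" "x < 1"
  defines "q \<equiv> \<beta> - \<alpha> - (\<alpha> + \<beta> + 1) * x" and "\<rho> \<equiv> (\<alpha> + \<beta> + 1) / 2"
  shows "\<bar>2 * wt x * flux x * poly y x / (1 - x\<^sup>2) * (\<rho>\<^sup>2 - \<rho> + (q / 2 + x) * q / (2 * (1 - x\<^sup>2)))\<bar>
    \<le> growth / N * (1 / ((1 - x\<^sup>2) * sqrt (1 - x\<^sup>2))) * energy x"
proof -
  define D Q where DQ: "D = 1 - x\<^sup>2" "Q = \<bar>\<beta> - \<alpha>\<bar> + \<bar>\<alpha> + \<beta> + 1\<bar>"
  have D: "0 < D" "D \<le> 1" using one_minus_square_pos[OF x] by (auto simp: DQ)
  have x1: "\<bar>x\<bar> \<le> 1" using x by auto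
  have q: "\<bar>q\<bar> \<le> Q" using linear_coeff_bound[OF x1] by (simp add: q_def DQ)
  have 0: "\<bar>(q / 2 + x) * q / 2\<bar> \<le> (Q / 2 + 1) * Q / 2"
  proof -
    have "\<bar>q / 2 + x\<bar> \<le> Q / 2 + 1" using q x1 by (auto simp: abs_if split: if_splits)
    then have "\<bar>q / 2 + x\<bar> * \<bar>q\<bar> \<le> (Q / 2 + 1) * Q"
      using q by (intro mult_mono) auto
    then show ?thesis by (simp add: abs_mult)
  qed
  have 01: "\<bar>\<rho>\<^sup>2 - \<rho>\<bar> * D \<le> \<bar>\<rho>\<^sup>2 - \<rho>\<bar>" using D by (intro mult_left_le) auto
  have "\<bar>(\<rho>\<^sup>2 - \<rho>) * D + (q / 2 + x) * q / 2\<bar> \<le> growth"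
  proof -
    have "\<bar>(\<rho>\<^sup>2 - \<rho>) * D\<bar> = \<bar>\<rho>\<^sup>2 - \<rho>\<bar> * D" using D by (simp add: abs_mult)
    then show ?thesis
      using 0 01 unfolding growth_def \<rho>_def DQ by linarith
  qed
  then have "\<bar>(\<rho>\<^sup>2 - \<rho>) * D + (q / 2 + x) * q / 2\<bar> / D \<le> growth / D"
    using D by (intro divide_right_mono) auto
  moreover have "\<rho>\<^sup>2 - \<rho> + (q / 2 + x) * q / (2 * D) = ((\<rho>\<^sup>2 - \<rho>) * D + (q / 2 + x) * q / 2) / D"
    using D by (simp add: field_simps)
  ultimately have 1: "\<bar>\<rho>\<^sup>2 - \<rho> + (q / 2 + x) * q / (2 * D)\<bar> \<le> growth / D"
    using D by (simp add: abs_divide)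
  have sq: "sqrt D * sqrt D = D" using D by simp
  have "0 \<le> (N * \<bar>poly y x\<bar> - \<bar>flux x\<bar> / sqrt D)\<^sup>2" by simp
  also have "\<dots> = N\<^sup>2 * (poly y x)\<^sup>2 + (flux x)\<^sup>2 / D - 2 * N * \<bar>poly y x\<bar> * (\<bar>flux x\<bar> / sqrt D)"
    using D by (simp add: power2_diff power_mult_distrib power_divide)
  finally have "wt x * (2 * N * \<bar>poly y x\<bar> * (\<bar>flux x\<bar> / sqrt D)) \<le> energy x"
    unfolding energy_def DQ by (intro mult_left_mono) (use wt_pos[OF x] in auto)
  then have "wt x * (2 * N * \<bar>poly y x\<bar> * (\<bar>flux x\<bar> / sqrt D)) / (N * sqrt D) \<le> energy x / (N * sqrt D)"
    using D N_pos by (intro divide_right_mono) auto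
  moreover have "wt x * (2 * N * \<bar>poly y x\<bar> * (\<bar>flux x\<bar> / sqrt D)) / (N * sqrt D)
      = 2 * wt x * \<bar>flux x\<bar> * \<bar>poly y x\<bar> / (sqrt D * sqrt D)"
    using D N_pos by (simp add: divide_simps)
  ultimately have "2 * wt x * \<bar>flux x\<bar> * \<bar>poly y x\<bar> / D \<le> energy x / (N * sqrt D)"
    unfolding sq by simp
  then have 2: "\<bar>2 * wt x * flux x * poly y x / D\<bar> \<le> energy x / (N * sqrt D)"
    using D wt_pos[OF x] by (simp add: abs_mult)
  have "\<bar>2 * wt x * flux x * poly y x / D * (\<rho>\<^sup>2 - \<rho> + (q / 2 + x) * q / (2 * D))\<bar>
    \<le> energy x / (N * sqrt D) * (growth / D)"
    unfolding abs_mult[of "2 * wt x * flux x * poly y x / D"]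
    using 1 2 D N_pos energy_nonneg[OF x] by (intro mult_mono) auto
  then show ?thesis unfolding DQ by (simp add: field_simps)
qed

text \<open>The function \<open>x / sqrt (1 - x\<^sup>2)\<close> is the primitive of the rate in the previous bound.\<close>

lemma energy_comparison:
  assumes "\<epsilon> > 0" and x: "\<bar>x\<bar> < 1" "\<epsilon> / N\<^sup>2 \<le> 1 - x\<^sup>2" and z: "\<bar>z\<bar> < 1" "\<epsilon> / N\<^sup>2 \<le> 1 - z\<^sup>2"
  shows "energy x \<le> exp (2 * growth / sqrt \<epsilon>) * energy z"
proof -
  define T where "T x = x / sqrt (1 - x\<^sup>2)" for x :: real
  have dT: "(T has_real_derivative 1 / ((1 - x\<^sup>2) * sqrt (1 - x\<^sup>2))) (at x)" if "\<bar>x\<bar> < 1" for x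
  proof -
    have D: "0 < 1 - x\<^sup>2" using that one_minus_square_pos[of x] by auto
    define s where "s = sqrt (1 - x\<^sup>2)"
    have s: "s > 0" "s * s = 1 - x\<^sup>2" using D by (auto simp: s_def)
    have "(T has_real_derivative (s - x * (- (2 * x) * (inverse s / 2))) / (s * s)) (at x)"
      unfolding T_def s_def
      by (rule derivative_eq_intros refl | use D in \<open>simp; fail\<close>)+
    also have "(s - x * (- (2 * x) * (inverse s / 2))) / (s * s) = (s * s + x\<^sup>2) / (s * s * s)"
      using s by (simp add: field_simps power2_eq_square)
    also have "\<dots> = 1 / ((1 - x\<^sup>2) * sqrt (1 - x\<^sup>2))"
      unfolding s by (simp add: s_def)
    finally show ?thesis .
  qed
  \<comment> \<open>The cut-off limits the primitive to size \<open>N\<close>, which the rate factor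
    \<open>growth / N\<close> compensates exactly.\<close>
  have T: "\<bar>T x\<bar> \<le> N / sqrt \<epsilon>" if "\<bar>x\<bar> < 1" "\<epsilon> / N\<^sup>2 \<le> 1 - x\<^sup>2" for x
  proof -
    have "sqrt (\<epsilon> / N\<^sup>2) \<le> sqrt (1 - x\<^sup>2)" using that by (intro real_sqrt_le_mono)
    then have *: "sqrt \<epsilon> / N \<le> sqrt (1 - x\<^sup>2)" using N_pos by (simp add: real_sqrt_divide)
    have "\<bar>T x\<bar> = \<bar>x\<bar> / sqrt (1 - x\<^sup>2)" using that by (simp add: T_def abs_divide abs_square_le_1)
    also have "\<dots> \<le> 1 / (sqrt \<epsilon> / N)"
      using * that \<open>\<epsilon> > 0\<close> N_pos by (intro frac_le) auto
    finally show ?thesis by simp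
  qed
  have g: "growth \<ge> 0" by (simp add: growth_def)
  have key: "energy u * 1 \<le> energy w * exp (2 * growth / sqrt \<epsilon>)"
    if "energy u \<le> energy w * exp (growth / N * (T b - T a))"
      "\<bar>a\<bar> < 1" "\<epsilon> / N\<^sup>2 \<le> 1 - a\<^sup>2" "\<bar>b\<bar> < 1" "\<epsilon> / N\<^sup>2 \<le> 1 - b\<^sup>2" "\<bar>w\<bar> < 1" for u w a b
  proof -
    have "growth / N * (T b - T a) \<le> growth / N * (2 * (N / sqrt \<epsilon>))"
      using T[OF that(2,3)] T[OF that(4,5)] g N_pos by (intro mult_left_mono) auto
    also have "\<dots> = 2 * growth / sqrt \<epsilon>" using N_pos by simp
    finally have "energy w * exp (growth / N * (T b - T a)) \<le> energy w * exp (2 * growth / sqrt \<epsilon>)"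
      using that energy_nonneg[of w] by (intro mult_left_mono) auto
    then show ?thesis using that by linarith
  qed
  show ?thesis
  proof (cases "x \<le> z")
    case True
    have "energy x \<le> energy z * exp (growth / N * (T z - T x))"
      by (rule gronwall_comparison(2)[OF True energy_deriv dT energy_deriv_bound])
        (use x z in auto)
    from key[OF this] show ?thesis using x z by (simp add: mult.commute)
  next
    case False
    have "energy x \<le> energy z * exp (growth / N * (T x - T z))"
      by (rule gronwall_comparison(1)[OF _ energy_deriv dT energy_deriv_bound])
        (use x z False in auto)
    from key[OF this] show ?thesis using x z by (simp add: mult.commute)
  qed
qed

end

section \<open>Endpoint layers and interior bounds\<close>

lemma powr_comparable:
  fixes s t e :: real
  assumes "0 < s" "s / 2 \<le> t" "t \<le> 2 * s"
  shows "t powr e \<le> 2 powr \<bar>e\<bar> * s powr e"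
proof -
  have "(t / s) powr e \<le> 2 powr \<bar>e\<bar>"
  proof (cases "e \<ge> 0")
    case True
    have "(t / s) powr e \<le> 2 powr e" using assms True by (intro powr_mono2) (auto simp: field_simps)
    then show ?thesis using True by simp
  next
    case False
    have "(t / s) powr e \<le> (1/2) powr e" using assms False by (intro powr_mono2') (auto simp: field_simps)
    also have "\<dots> = 2 powr (-e)" by (simp add: powr_divide powr_minus field_simps)
    finally show ?thesis using False by simp
  qed
  then show ?thesis using assms by (simp add: powr_divide field_simps)
qed

context jacobi_ode
begin

text \<open>The entry \<open>1/4\<close> together with \<open>N \<ge> 1/2\<close> gives
  \<open>layer \<le> 1\<close>. The next entry makes the mean value estimate over the layer at 1
  lose at most a third of the maximum. The last one is its mirror image, so that the layers at both
  ends have the same width.\<close>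

definition near_radius :: real where
  "near_radius = min (1/4) (min ((\<alpha> + 1) / (3 * 2 powr \<bar>\<beta>\<bar>)) ((\<beta> + 1) / (3 * 2 powr \<bar>\<alpha>\<bar>)))"

definition layer :: real where "layer = near_radius / N\<^sup>2"

lemma near_radius_pos: "near_radius > 0" and near_radius_le: "near_radius \<le> 1/4"
  using alpha beta by (auto simp: near_radius_def)

lemma layer_pos: "layer > 0" and layer_le_1: "layer \<le> 1"
proof -
  show "layer > 0" using near_radius_pos N_pos by (simp add: layer_def)
  have "(1/2)\<^sup>2 \<le> N\<^sup>2" using N_ge by (intro power_mono) auto
  then show "layer \<le> 1" using near_radius_le N_pos by (simp add: layer_def divide_le_eq power2_eq_square)
qed

text \<open>In self-adjoint form \<open>g\<close> vanishes at 1 and has derivative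
  \<open>- l\<close> times weight times \<open>y\<close>. Rather than integrating, the proof
  compares \<open>g\<close> with the explicit \<open>h\<close> through the monotonicity of
  \<open>g - h\<close> and \<open>- g - h\<close>. Cancelling the common power of
  \<open>1 - x\<close> leaves a bound that does not degenerate at the endpoint.\<close>

lemma near_one_deriv:
  assumes x: "0 \<le> x" "x < 1" and M: "\<And>t. x \<le> t \<Longrightarrow> t \<le> 1 \<Longrightarrow> \<bar>poly y t\<bar> \<le> M"
  shows "\<bar>poly (pderiv y) x\<bar> \<le> 2 powr \<bar>\<beta>\<bar> / (\<alpha> + 1) * N\<^sup>2 * M"
proof -
  define l where "l = N\<^sup>2 - ((\<alpha> + \<beta> + 1) / 2)\<^sup>2"
  have l: "0 \<le> l" "l \<le> N\<^sup>2" using eigenvalue_nonneg by (auto simp: l_def)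
  have M0: "0 \<le> M" using M[of 1] x by linarith
  define g where "g t = (1 - t) powr (\<alpha> + 1) * (1 + t) powr (\<beta> + 1) * poly (pderiv y) t" for t
  define K where "K = l * M * 2 powr \<bar>\<beta>\<bar>"
  define h where "h t = K / (\<alpha> + 1) * (1 - t) powr (\<alpha> + 1)" for t
  have dg: "(g has_real_derivative - l * ((1 - t) powr \<alpha> * (1 + t) powr \<beta>) * poly y t) (at t)"
    if t: "x < t" "t < 1" for t
  proof -
    define y0 y1 y2 where defs: "y0 = poly y t" "y1 = poly (pderiv y) t" "y2 = poly (pderiv (pderiv y)) t"
    have "(g has_real_derivative
        ((\<alpha> + 1) * (1 - t) powr \<alpha> * (- 1) * (1 + t) powr (\<beta> + 1)
         + (1 - t) powr (\<alpha> + 1) * ((\<beta> + 1) * (1 + t) powr \<beta>)) * y1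
        + (1 - t) powr (\<alpha> + 1) * (1 + t) powr (\<beta> + 1) * y2) (at t)"
      unfolding g_def[abs_def] defs using t x
      by (auto intro!: derivative_eq_intros simp: algebra_simps)
    also have "((\<alpha> + 1) * (1 - t) powr \<alpha> * (- 1) * (1 + t) powr (\<beta> + 1)
         + (1 - t) powr (\<alpha> + 1) * ((\<beta> + 1) * (1 + t) powr \<beta>)) * y1
        + (1 - t) powr (\<alpha> + 1) * (1 + t) powr (\<beta> + 1) * y2
      = (1 - t) powr \<alpha> * (1 + t) powr \<beta> * ((- (\<alpha> + 1) * (1 + t) + (\<beta> + 1) * (1 - t)) * y1 + (1 - t\<^sup>2) * y2)"
      using x t by (simp add: powr_add power2_eq_square) (simp add: algebra_simps)
    also have "(- (\<alpha> + 1) * (1 + t) + (\<beta> + 1) * (1 - t)) * y1 + (1 - t\<^sup>2) * y2 = - l * y0"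
      using ode[of t] unfolding l_def defs by (simp add: algebra_simps)
    finally show ?thesis by (simp add: defs mult_ac)
  qed
  have dh: "(h has_real_derivative - K * (1 - t) powr \<alpha>) (at t)" if t: "x < t" "t < 1" for t
    unfolding h_def[abs_def] using t x alpha by (auto intro!: derivative_eq_intros)
  have bound: "\<bar>- l * ((1 - t) powr \<alpha> * (1 + t) powr \<beta>) * poly y t\<bar> \<le> K * (1 - t) powr \<alpha>"
    if t: "x < t" "t < 1" for t
  proof -
    have "(1 + t) powr \<beta> \<le> 2 powr \<bar>\<beta>\<bar> * 1 powr \<beta>"
      using x t by (intro powr_comparable) auto
    then have "l * (1 - t) powr \<alpha> * ((1 + t) powr \<beta> * \<bar>poly y t\<bar>) \<le> l * (1 - t) powr \<alpha> * (2 powr \<bar>\<beta>\<bar> * M)"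
      using M[of t] t l by (intro mult_left_mono mult_mono) auto
    then show ?thesis using l by (simp add: abs_mult K_def mult_ac)
  qed
  have cg: "continuous_on {x..1} g" "continuous_on {x..1} h"
    unfolding g_def h_def using x alpha beta by (auto intro!: continuous_intros continuous_on_powr')
  have 1: "g x - h x \<le> g 1 - h 1"
  proof (rule DERIV_nonneg_imp_increasing_open[where a = x and b = 1 and f = "\<lambda>t. g t - h t"])
    fix t assume t: "x < t" "t < 1"
    show "\<exists>d. ((\<lambda>t. g t - h t) has_real_derivative d) (at t) \<and> 0 \<le> d"
      by (rule exI, rule conjI, rule DERIV_diff[OF dg[OF t] dh[OF t]]) (use bound[OF t] in linarith)
  qed (use x cg in \<open>auto intro!: continuous_intros\<close>)
  have 2: "- g x - h x \<le> - g 1 - h 1"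
  proof (rule DERIV_nonneg_imp_increasing_open[where a = x and b = 1 and f = "\<lambda>t. - g t - h t"])
    fix t assume t: "x < t" "t < 1"
    show "\<exists>d. ((\<lambda>t. - g t - h t) has_real_derivative d) (at t) \<and> 0 \<le> d"
      by (rule exI, rule conjI, rule DERIV_diff[OF DERIV_minus[OF dg[OF t]] dh[OF t]]) (use bound[OF t] in linarith)
  qed (use x cg in \<open>auto intro!: continuous_intros\<close>)
  have "g 1 = 0" "h 1 = 0" by (simp_all add: g_def h_def)
  with 1 2 have "\<bar>g x\<bar> \<le> h x" by linarith
  then have "(1 - x) powr (\<alpha> + 1) * ((1 + x) powr (\<beta> + 1) * \<bar>poly (pderiv y) x\<bar>)
      \<le> (1 - x) powr (\<alpha> + 1) * (K / (\<alpha> + 1))"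
    by (simp add: g_def h_def abs_mult mult_ac)
  then have "(1 + x) powr (\<beta> + 1) * \<bar>poly (pderiv y) x\<bar> \<le> K / (\<alpha> + 1)"
    by (rule mult_left_le_imp_le) (use x in \<open>simp\<close>)
  moreover have "1 * \<bar>poly (pderiv y) x\<bar> \<le> (1 + x) powr (\<beta> + 1) * \<bar>poly (pderiv y) x\<bar>"
    using x beta by (intro mult_right_mono ge_one_powr_ge_zero) auto
  moreover have "K / (\<alpha> + 1) \<le> 2 powr \<bar>\<beta>\<bar> / (\<alpha> + 1) * N\<^sup>2 * M"
  proof -
    have "K \<le> N\<^sup>2 * M * 2 powr \<bar>\<beta>\<bar>"
      unfolding K_def using l M0 by (intro mult_right_mono) auto
    then have "K / (\<alpha> + 1) \<le> N\<^sup>2 * M * 2 powr \<bar>\<beta>\<bar> / (\<alpha> + 1)"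
      using alpha by (intro divide_right_mono) auto
    then show ?thesis by (simp add: mult_ac)
  qed
  ultimately show ?thesis by linarith
qed

text \<open>With \<open>M\<close> the maximum of \<open>\<bar>y\<bar>\<close> on the layer, the mean
  value theorem and \<open>near_one_deriv\<close> bound the variation by \<open>M / 3\<close>. At
  the maximum point this reads \<open>M \<le> \<bar>y 1\<bar> + M / 3\<close>, hence
  \<open>M \<le> 3/2 * \<bar>y 1\<bar>\<close>, which closes both estimates.\<close>

lemma near_one:
  assumes x: "1 - layer \<le> x" "x \<le> 1"
  shows "\<bar>poly y x - poly y 1\<bar> \<le> \<bar>poly y 1\<bar> / 2"
    and "x < 1 \<Longrightarrow> \<bar>poly (pderiv y) x\<bar> \<le> 2 powr \<bar>\<beta>\<bar> / (\<alpha> + 1) * N\<^sup>2 * (3/2 * \<bar>poly y 1\<bar>)"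
proof -
  define x0 where "x0 = 1 - layer"
  have x0: "0 \<le> x0" "x0 < 1" using layer_pos layer_le_1 by (auto simp: x0_def)
  have "continuous_on {x0..1} (\<lambda>t. \<bar>poly y t\<bar>)" by (intro continuous_intros)
  then obtain z where z: "z \<in> {x0..1}" and zM: "\<And>t. t \<in> {x0..1} \<Longrightarrow> \<bar>poly y t\<bar> \<le> \<bar>poly y z\<bar>"
    using continuous_attains_sup[of "{x0..1}" "\<lambda>t. \<bar>poly y t\<bar>"] x0 by auto
  define M where "M = \<bar>poly y z\<bar>"
  define C where "C = 2 powr \<bar>\<beta>\<bar> / (\<alpha> + 1)"
  have C: "C > 0" using alpha by (simp add: C_def)
  have d: "\<bar>poly (pderiv y) t\<bar> \<le> C * N\<^sup>2 * M" if "x0 \<le> t" "t < 1" for t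
    unfolding C_def by (rule near_one_deriv) (use that x0 zM in \<open>auto simp: M_def\<close>)
  have "near_radius \<le> (\<alpha> + 1) / (3 * 2 powr \<bar>\<beta>\<bar>)" by (simp add: near_radius_def)
  then have Cr: "C * near_radius \<le> 1/3" using alpha by (simp add: C_def field_simps)
  have diff: "\<bar>poly y t - poly y 1\<bar> \<le> M / 3" if t: "x0 \<le> t" "t \<le> 1" for t
  proof (cases "t = 1")
    case False
    then have "t < 1" using t by simp
    from poly_MVT[OF this, of y] obtain s where s: "t < s" "s < 1"
      "poly y 1 - poly y t = (1 - t) * poly (pderiv y) s" by auto
    have "\<bar>poly y t - poly y 1\<bar> = (1 - t) * \<bar>poly (pderiv y) s\<bar>"
      using s(3) t by (simp add: abs_minus_commute abs_mult)
    also have "\<dots> \<le> layer * (C * N\<^sup>2 * M)"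
      using t s d[of s] layer_pos by (intro mult_mono) (auto simp: x0_def)
    also have "\<dots> = C * near_radius * M" using N_pos by (simp add: layer_def)
    also have "\<dots> \<le> 1/3 * M" using Cr by (intro mult_right_mono) (auto simp: M_def)
    finally show ?thesis by simp
  qed (simp add: M_def)
  have "\<bar>poly y z - poly y 1\<bar> \<le> M / 3" using diff[of z] z by simp
  then have M: "M \<le> 3/2 * \<bar>poly y 1\<bar>" unfolding M_def by linarith
  show "\<bar>poly y x - poly y 1\<bar> \<le> \<bar>poly y 1\<bar> / 2"
    using diff[of x] x M by (simp add: x0_def)
  assume "x < 1"
  then have "\<bar>poly (pderiv y) x\<bar> \<le> C * N\<^sup>2 * M" using d x by (simp add: x0_def)
  also have "\<dots> \<le> C * N\<^sup>2 * (3/2 * \<bar>poly y 1\<bar>)" using M C by (intro mult_left_mono) auto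
  finally show "\<bar>poly (pderiv y) x\<bar> \<le> 2 powr \<bar>\<beta>\<bar> / (\<alpha> + 1) * N\<^sup>2 * (3/2 * \<bar>poly y 1\<bar>)"
    by (simp add: C_def)
qed

lemma reflected: "jacobi_ode \<beta> \<alpha> N (pcompose y [:0, -1:])"
proof
  have *: "pderiv [:0, -1 :: real:] = [:-1:]" by (simp add: pderiv_pCons)
  show "(1 - x\<^sup>2) * poly (pderiv (pderiv (y \<circ>\<^sub>p [:0, - 1:]))) x +
      (\<alpha> - \<beta> - (\<beta> + \<alpha> + 2) * x) * poly (pderiv (y \<circ>\<^sub>p [:0, - 1:])) x +
      (N\<^sup>2 - ((\<beta> + \<alpha> + 1) / 2)\<^sup>2) * poly (y \<circ>\<^sub>p [:0, - 1:]) x = 0" for x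
    using ode[of "-x"] by (simp add: pderiv_pcompose * pderiv_mult pderiv_smult pderiv_minus poly_pcompose algebra_simps)
qed (use alpha beta N_ge eigenvalue_nonneg in \<open>auto simp: add_ac\<close>)

text \<open>The factor of \<open>energy_comparison\<close> for
  \<open>\<epsilon> = near_radius / 4\<close>, that is, for the cut-off \<open>layer / 4\<close>.
  The quarter leaves room for the mean value points of \<open>nodal_near\<close>, which may be half
  as far from 1 as a node and as close as \<open>1/2\<close> to -1.\<close>

definition growth_const :: real where
  "growth_const = exp (2 * growth / sqrt (near_radius / 4))"

definition amplitude :: real where "amplitude = sqrt (energy 0)"

definition root_wt :: "real \<Rightarrow> real" where
  "root_wt x = (1 - x) powr (\<alpha> / 2 + 1/4) * (1 + x) powr (\<beta> / 2 + 1/4)"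

lemma root_wt_pos: "-1 < x \<Longrightarrow> x < 1 \<Longrightarrow> 0 < root_wt x"
  by (simp add: root_wt_def)

lemma wt_eq: "wt x = (root_wt x)\<^sup>2"
proof -
  have "t powr (c + 1/2) = (t powr (c / 2 + 1/4))\<^sup>2" for t c :: real
    unfolding power2_eq_square powr_add[symmetric] by simp
  then show ?thesis by (simp add: wt_def root_wt_def power_mult_distrib)
qed

lemma amplitude_nonneg: "amplitude \<ge> 0" and amplitude_sq: "amplitude\<^sup>2 = energy 0"
  using energy_nonneg[of 0] by (auto simp: amplitude_def)

lemma growth_const_ge_1: "growth_const \<ge> 1"
proof -
  have "growth \<ge> 0" by (simp add: growth_def)
  then show ?thesis using near_radius_pos by (simp add: growth_const_def)
qed

lemma energy_amplitude:
  assumes x: "\<bar>x\<bar> < 1" "layer / 4 \<le> 1 - x\<^sup>2"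
  shows "energy x \<le> growth_const * amplitude\<^sup>2" and "amplitude\<^sup>2 \<le> growth_const * energy x"
proof -
  have e: "near_radius / 4 / N\<^sup>2 = layer / 4" by (simp add: layer_def)
  have z: "\<bar>0\<bar> < (1::real)" "near_radius / 4 / N\<^sup>2 \<le> 1 - 0\<^sup>2" using layer_le_1 e by auto
  have p: "near_radius / 4 > 0" using near_radius_pos by simp
  have x': "near_radius / 4 / N\<^sup>2 \<le> 1 - x\<^sup>2" using x e by simp
  show "energy x \<le> growth_const * amplitude\<^sup>2" "amplitude\<^sup>2 \<le> growth_const * energy x"
    using energy_comparison[OF p x(1) x' z] energy_comparison[OF p z x(1) x']
    by (auto simp: growth_const_def amplitude_sq)
qed

definition coeff_bound :: real where "coeff_bound = \<bar>\<beta> - \<alpha>\<bar> + \<bar>\<alpha> + \<beta> + 1\<bar>"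

text \<open>Each of the two squares in the energy is at most the energy. Recovering the derivative
  from the flux costs a multiple of \<open>\<bar>y\<bar>\<close>, which is of the same order because
  \<open>2 * N * sqrt (1 - x\<^sup>2) \<ge> sqrt near_radius\<close> on this range.\<close>

lemma interior_bounds:
  assumes x: "\<bar>x\<bar> < 1" "layer / 4 \<le> 1 - x\<^sup>2"
  shows "root_wt x * (N * \<bar>poly y x\<bar>) \<le> sqrt growth_const * amplitude"
    and "root_wt x * (sqrt (1 - x\<^sup>2) * \<bar>poly (pderiv y) x\<bar>)
      \<le> sqrt growth_const * (1 + coeff_bound / sqrt near_radius) * amplitude"
proof -
  define D where "D = 1 - x\<^sup>2"
  have x1: "-1 < x" "x < 1" using x by auto
  have D: "0 < D" using one_minus_square_pos[OF x1] by (simp add: D_def)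
  have e: "energy x = (root_wt x * (N * \<bar>poly y x\<bar>))\<^sup>2 + (root_wt x * (\<bar>flux x\<bar> / sqrt D))\<^sup>2"
    using D by (simp add: energy_def wt_eq D_def power_mult_distrib power_divide algebra_simps)
  have key: "a \<le> sqrt growth_const * amplitude" if "a\<^sup>2 \<le> energy x" for a
  proof (rule power2_le_imp_le)
    show "a\<^sup>2 \<le> (sqrt growth_const * amplitude)\<^sup>2"
      using that energy_amplitude(1)[OF x] growth_const_ge_1 by (simp add: power_mult_distrib)
    show "0 \<le> sqrt growth_const * amplitude" using growth_const_ge_1 amplitude_nonneg by simp
  qed
  show 1: "root_wt x * (N * \<bar>poly y x\<bar>) \<le> sqrt growth_const * amplitude"
    by (rule key) (simp add: e)
  have 2: "root_wt x * (\<bar>flux x\<bar> / sqrt D) \<le> sqrt growth_const * amplitude"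
    by (rule key) (simp add: e)
  have "\<bar>D * poly (pderiv y) x\<bar> \<le> \<bar>flux x\<bar> + coeff_bound / 2 * \<bar>poly y x\<bar>"
  proof -
    have "\<bar>(\<beta> - \<alpha> - (\<alpha> + \<beta> + 1) * x) / 2 * poly y x\<bar> \<le> coeff_bound / 2 * \<bar>poly y x\<bar>"
      unfolding abs_mult using linear_coeff_bound[of x] x
      by (intro mult_right_mono) (auto simp: coeff_bound_def)
    then show ?thesis unfolding flux_def D_def by linarith
  qed
  then have "sqrt D * \<bar>poly (pderiv y) x\<bar> \<le> (\<bar>flux x\<bar> + coeff_bound / 2 * \<bar>poly y x\<bar>) / sqrt D"
    using D by (simp add: abs_mult pos_le_divide_eq mult_ac) (simp flip: mult.assoc)
  also have "\<dots> = \<bar>flux x\<bar> / sqrt D + coeff_bound * (N * \<bar>poly y x\<bar>) * (1 / (2 * N * sqrt D))"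
    using N_pos by (simp add: add_divide_distrib)
  also have "\<dots> \<le> \<bar>flux x\<bar> / sqrt D + coeff_bound * (N * \<bar>poly y x\<bar>) * (1 / sqrt near_radius)"
  proof -
    have "sqrt (layer / 4) \<le> sqrt D" using x by (simp add: D_def)
    moreover have "sqrt (layer / 4) = sqrt near_radius / (2 * N)"
      using N_pos by (simp add: layer_def real_sqrt_divide real_sqrt_mult)
    ultimately have "sqrt near_radius / (2 * N) \<le> sqrt D" by (simp only:)
    then have "sqrt near_radius \<le> 2 * N * sqrt D" using N_pos by (simp add: pos_divide_le_eq mult_ac)
    then have "1 / (2 * N * sqrt D) \<le> 1 / sqrt near_radius"
      using near_radius_pos by (intro divide_left_mono) (use N_pos D in auto)
    then show ?thesis using N_pos by (intro add_left_mono mult_left_mono) (auto simp: coeff_bound_def)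
  qed
  finally have "root_wt x * (sqrt D * \<bar>poly (pderiv y) x\<bar>)
      \<le> root_wt x * (\<bar>flux x\<bar> / sqrt D + coeff_bound * (N * \<bar>poly y x\<bar>) * (1 / sqrt near_radius))"
    using root_wt_pos[OF x1] by (intro mult_left_mono) auto
  also have "\<dots> = root_wt x * (\<bar>flux x\<bar> / sqrt D)
      + coeff_bound / sqrt near_radius * (root_wt x * (N * \<bar>poly y x\<bar>))"
    by (simp add: algebra_simps)
  also have "\<dots> \<le> sqrt growth_const * amplitude + coeff_bound / sqrt near_radius * (sqrt growth_const * amplitude)"
    using 1 2 near_radius_pos by (intro add_mono mult_left_mono) (auto simp: coeff_bound_def)
  finally show "root_wt x * (sqrt (1 - x\<^sup>2) * \<bar>poly (pderiv y) x\<bar>)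
      \<le> sqrt growth_const * (1 + coeff_bound / sqrt near_radius) * amplitude"
    by (simp add: D_def algebra_simps)
qed

text \<open>At a root the energy consists of the derivative term alone, so the derivative carries
  the whole amplitude.\<close>

lemma root_deriv_bound:
  assumes x: "\<bar>x\<bar> < 1" "layer / 4 \<le> 1 - x\<^sup>2" and "poly y x = 0"
  shows "amplitude \<le> sqrt growth_const * (root_wt x * (sqrt (1 - x\<^sup>2) * \<bar>poly (pderiv y) x\<bar>))"
proof (rule power2_le_imp_le)
  have x1: "-1 < x" "x < 1" using x by auto
  have D: "0 < 1 - x\<^sup>2" using one_minus_square_pos[OF x1] .
  have "energy x = (root_wt x * (sqrt (1 - x\<^sup>2) * \<bar>poly (pderiv y) x\<bar>))\<^sup>2"
    using D \<open>poly y x = 0\<close>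
    by (simp add: energy_def flux_def wt_eq power_mult_distrib power2_eq_square[of "1 - x\<^sup>2"])
  then show "amplitude\<^sup>2 \<le> (sqrt growth_const * (root_wt x * (sqrt (1 - x\<^sup>2) * \<bar>poly (pderiv y) x\<bar>)))\<^sup>2"
    using energy_amplitude(2)[OF x] growth_const_ge_1 by (simp add: power_mult_distrib)
  show "0 \<le> sqrt growth_const * (root_wt x * (sqrt (1 - x\<^sup>2) * \<bar>poly (pderiv y) x\<bar>))"
    using growth_const_ge_1 root_wt_pos[OF x1] D by simp
qed

end

context jacobi_ode
begin

definition nodal :: "real poly" where "nodal = [:1, 0, -1:] * y"

definition dist_right :: "real \<Rightarrow> real" where "dist_right x = max (1 - x) layer"
definition dist_left :: "real \<Rightarrow> real" where "dist_left x = max (1 + x) layer"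

lemma poly_nodal: "poly nodal x = (1 - x) * (1 + x) * poly y x"
  by (simp add: nodal_def algebra_simps)

lemma poly_pderiv_nodal: "poly (pderiv nodal) x = (1 - x\<^sup>2) * poly (pderiv y) x - 2 * x * poly y x"
  unfolding nodal_def pderiv_mult by (simp add: pderiv_pCons algebra_simps power2_eq_square)

lemma N_eq: "N = sqrt near_radius / sqrt layer"
  using N_pos near_radius_pos by (simp add: layer_def real_sqrt_divide)

text \<open>At the inner edge of the layer both the endpoint estimates and the interior estimates
  are available, and matching them relates \<open>y 1\<close> to the amplitude. As \<open>N\<close>
  is a multiple of \<open>1 / sqrt layer\<close>, it lowers the exponent
  \<open>\<alpha> / 2 + 1/4\<close> of \<open>layer\<close> by \<open>1/2\<close>.\<close>

lemma boundary_point: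
  fixes x :: real
  assumes "x = 1 - layer"
  shows "\<bar>x\<bar> < 1" and "layer \<le> 1 - x\<^sup>2" and "1 - x\<^sup>2 \<le> 2 * layer"
    and "root_wt x * N = sqrt near_radius * layer powr (\<alpha> / 2 - 1/4) * (1 + x) powr (\<beta> / 2 + 1/4)"
    and "(1 + x) powr (\<beta> / 2 + 1/4) \<le> 2 powr \<bar>\<beta> / 2 + 1/4\<bar>"
    and "1 \<le> 2 powr \<bar>\<beta> / 2 + 1/4\<bar> * (1 + x) powr (\<beta> / 2 + 1/4)"
proof -
  show "\<bar>x\<bar> < 1" using layer_pos layer_le_1 assms by auto
  have D: "1 - x\<^sup>2 = layer * (2 - layer)" by (simp add: assms power2_eq_square algebra_simps)
  show "layer \<le> 1 - x\<^sup>2" "1 - x\<^sup>2 \<le> 2 * layer"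
    unfolding D using mult_left_mono[of 1 "2 - layer" layer] mult_left_mono[of "2 - layer" 2 layer]
      layer_pos layer_le_1 by (simp_all add: mult.commute)
  have "layer powr (\<alpha> / 2 + 1/4) = layer powr (\<alpha> / 2 - 1/4) * sqrt layer"
    using layer_pos by (simp add: powr_half_sqrt[symmetric] add.commute flip: powr_add)
  then have "root_wt x * (sqrt near_radius / sqrt layer)
      = sqrt near_radius * layer powr (\<alpha> / 2 - 1/4) * (1 + x) powr (\<beta> / 2 + 1/4)"
    using layer_pos unfolding root_wt_def assms by simp
  then show "root_wt x * N = sqrt near_radius * layer powr (\<alpha> / 2 - 1/4) * (1 + x) powr (\<beta> / 2 + 1/4)"
    using N_eq by (metis (no_types))
  have x: "1 \<le> 1 + x" "1 + x \<le> 2" using assms layer_pos layer_le_1 by auto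
  show "(1 + x) powr (\<beta> / 2 + 1/4) \<le> 2 powr \<bar>\<beta> / 2 + 1/4\<bar>"
    using powr_comparable[of 1 "1 + x" "\<beta> / 2 + 1/4"] x by simp
  show "1 \<le> 2 powr \<bar>\<beta> / 2 + 1/4\<bar> * (1 + x) powr (\<beta> / 2 + 1/4)"
    using powr_comparable[of "1 + x" 1 "\<beta> / 2 + 1/4"] x by simp
qed

end

section \<open>Endpoint values compared with the amplitude\<close>

lemma powr_shift: "0 < (t::real) \<Longrightarrow> u \<le> c * t powr a \<longleftrightarrow> u * t powr (- a) \<le> c"
  by (simp add: powr_minus field_simps)

lemma powr_shift': "0 < (t::real) \<Longrightarrow> u * t powr a \<le> c \<longleftrightarrow> u \<le> c * t powr (- a)"
  by (simp add: powr_minus field_simps)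

text \<open>At \<open>x = 1 - layer\<close> the lower bound
  \<open>\<bar>y 1\<bar> / 2 \<le> \<bar>y x\<bar>\<close> meets the interior upper bound. The
  maximum with 1 makes the constant positive.\<close>

lemma endpoint_upper:
  assumes "\<alpha> > -1" "\<beta> > -1"
  shows "\<exists>C>0. \<forall>N y. jacobi_ode \<alpha> \<beta> N y \<longrightarrow>
    \<bar>poly y 1\<bar> \<le> C * jacobi_ode.amplitude \<alpha> \<beta> N y * jacobi_ode.layer \<alpha> \<beta> N powr (1/4 - \<alpha> / 2)"
proof -
  let ?G = "sqrt (jacobi_ode.growth_const \<alpha> \<beta>)" and ?r = "sqrt (jacobi_ode.near_radius \<alpha> \<beta>)"
  let ?b = "2 powr \<bar>\<beta> / 2 + 1/4\<bar>"
  have *: "\<bar>poly y 1\<bar> \<le> max 1 (2 * ?b * ?G / ?r) * jacobi_ode.amplitude \<alpha> \<beta> N y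
      * jacobi_ode.layer \<alpha> \<beta> N powr (1/4 - \<alpha> / 2)" if "jacobi_ode \<alpha> \<beta> N y" for N y
  proof -
    interpret jacobi_ode \<alpha> \<beta> N y by fact
    define x where "x = 1 - layer"
    note b = boundary_point[OF x_def]
    have r: "?r > 0" using near_radius_pos by simp
    have "\<bar>poly y x - poly y 1\<bar> \<le> \<bar>poly y 1\<bar> / 2"
      using near_one(1)[of x] layer_pos by (simp add: x_def)
    then have half: "\<bar>poly y 1\<bar> / 2 \<le> \<bar>poly y x\<bar>" by linarith
    have "?r * layer powr (\<alpha> / 2 - 1/4) * (1 + x) powr (\<beta> / 2 + 1/4) * \<bar>poly y x\<bar> \<le> ?G * amplitude"
      using interior_bounds(1)[OF b(1)] b(2) layer_pos unfolding b(4)[symmetric] by (simp add: mult.assoc)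
    then have "layer powr (\<alpha> / 2 - 1/4) * (1 + x) powr (\<beta> / 2 + 1/4) * \<bar>poly y x\<bar> \<le> ?G / ?r * amplitude"
      using r by (simp add: field_simps)
    then have "?b * (layer powr (\<alpha> / 2 - 1/4) * (1 + x) powr (\<beta> / 2 + 1/4) * \<bar>poly y x\<bar>) \<le> ?b * (?G / ?r * amplitude)"
      by (intro mult_left_mono) auto
    moreover have "1 * (layer powr (\<alpha> / 2 - 1/4) * (\<bar>poly y 1\<bar> / 2))
        \<le> (?b * (1 + x) powr (\<beta> / 2 + 1/4)) * (layer powr (\<alpha> / 2 - 1/4) * \<bar>poly y x\<bar>)"
      using b(6) half by (intro mult_mono) auto
    ultimately have "\<bar>poly y 1\<bar> * layer powr (\<alpha> / 2 - 1/4) \<le> (2 * ?b * ?G / ?r) * amplitude"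
      by (simp add: mult_ac)
    also have "\<dots> \<le> max 1 (2 * ?b * ?G / ?r) * amplitude"
      using amplitude_nonneg by (intro mult_right_mono) auto
    finally show ?thesis using powr_shift'[OF layer_pos] by simp
  qed
  show ?thesis
    by (rule exI[of _ "max 1 (2 * ?b * ?G / ?r)"]) (use * in auto)
qed

text \<open>At \<open>x = 1 - layer\<close> the energy is comparable to
  \<open>amplitude\<^sup>2\<close>, while both of its terms are controlled by \<open>y 1\<close>
  through the layer estimates for \<open>y\<close> and \<open>y'\<close>.\<close>

lemma endpoint_lower:
  assumes "\<alpha> > -1" "\<beta> > -1"
  shows "\<exists>C>0. \<forall>N y. jacobi_ode \<alpha> \<beta> N y \<longrightarrow>
    jacobi_ode.amplitude \<alpha> \<beta> N y * jacobi_ode.layer \<alpha> \<beta> N powr (1/4 - \<alpha> / 2) \<le> C * \<bar>poly y 1\<bar>"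
proof -
  let ?G = "sqrt (jacobi_ode.growth_const \<alpha> \<beta>)" and ?r = "sqrt (jacobi_ode.near_radius \<alpha> \<beta>)"
  let ?b = "2 powr \<bar>\<beta> / 2 + 1/4\<bar>"
  let ?c = "2 powr \<bar>\<beta>\<bar> / (\<alpha> + 1) * (3/2)"
  let ?Q = "jacobi_ode.coeff_bound \<alpha> \<beta>"
  define C where "C = ?G * ?b * ?r * (3/2 + 2 * ?c * ?r + ?Q / ?r)"
  have *: "jacobi_ode.amplitude \<alpha> \<beta> N y * jacobi_ode.layer \<alpha> \<beta> N powr (1/4 - \<alpha> / 2)
     \<le> max 1 C * \<bar>poly y 1\<bar>" if "jacobi_ode \<alpha> \<beta> N y" for N y
  proof -
    interpret jacobi_ode \<alpha> \<beta> N y by fact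
    define x where "x = 1 - layer"
    note b = boundary_point[OF x_def]
    define D where "D = 1 - x\<^sup>2"
    have r: "?r > 0" using near_radius_pos by simp
    have Q: "?Q \<ge> 0" by (simp add: coeff_bound_def)
    have D: "D > 0" "layer \<le> D" "D \<le> 2 * layer" using b(2,3) layer_pos unfolding D_def by auto
    have "D \<le> 4 * layer" using D layer_pos by linarith
    then have "sqrt D \<le> sqrt (4 * layer)" by (rule real_sqrt_le_mono)
    then have sD: "sqrt D \<le> 2 * sqrt layer" by (simp add: real_sqrt_mult)
    have isD: "1 / sqrt D \<le> 1 / sqrt layer" using D layer_pos by (intro divide_left_mono) auto
    have x: "-1 < x" "x < 1" using b(1) by auto
    have near: "\<bar>poly y x\<bar> \<le> 3/2 * \<bar>poly y 1\<bar>" "\<bar>poly (pderiv y) x\<bar> \<le> ?c * N\<^sup>2 * \<bar>poly y 1\<bar>"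
    proof -
      have l: "1 - layer \<le> x" "x \<le> 1" using x by (auto simp: x_def)
      show "\<bar>poly y x\<bar> \<le> 3/2 * \<bar>poly y 1\<bar>" using near_one(1)[OF l] by linarith
      show "\<bar>poly (pderiv y) x\<bar> \<le> ?c * N\<^sup>2 * \<bar>poly y 1\<bar>" using near_one(2)[OF l x(2)] by (simp add: mult_ac)
    qed
    have "\<bar>(\<beta> - \<alpha> - (\<alpha> + \<beta> + 1) * x) / 2 * poly y x\<bar> \<le> ?Q / 2 * \<bar>poly y x\<bar>"
      unfolding abs_mult using linear_coeff_bound[of x] x
      by (intro mult_right_mono) (auto simp: coeff_bound_def)
    moreover have "\<bar>D * poly (pderiv y) x\<bar> = D * \<bar>poly (pderiv y) x\<bar>" using D by (simp add: abs_mult)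
    ultimately have "\<bar>flux x\<bar> \<le> D * \<bar>poly (pderiv y) x\<bar> + ?Q / 2 * \<bar>poly y x\<bar>"
      unfolding flux_def D_def[symmetric] by linarith
    then have "\<bar>flux x\<bar> / sqrt D \<le> (D * \<bar>poly (pderiv y) x\<bar> + ?Q / 2 * \<bar>poly y x\<bar>) / sqrt D"
      using D by (intro divide_right_mono) auto
    also have "\<dots> = sqrt D * \<bar>poly (pderiv y) x\<bar> + 1 / sqrt D * (?Q / 2 * \<bar>poly y x\<bar>)"
    proof -
      have "(D * p + q) / sqrt D = D / sqrt D * p + 1 / sqrt D * q" for p q
        by (simp add: add_divide_distrib)
      then show ?thesis using D by (simp only: real_div_sqrt)
    qed
    also have "\<dots> \<le> 2 * sqrt layer * (?c * N\<^sup>2 * \<bar>poly y 1\<bar>) + 1 / sqrt layer * (?Q / 2 * (3/2 * \<bar>poly y 1\<bar>))"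
      using sD isD near Q D layer_pos by (intro add_mono mult_mono) auto
    also have "\<dots> = N * \<bar>poly y 1\<bar> * (2 * ?c * ?r + 3/4 * ?Q / ?r)"
    proof -
      \<comment> \<open>Since \<open>layer\<close> is a multiple of \<open>1 / N\<^sup>2\<close>,
        the derivative term and the zero-order term both scale like \<open>N\<close>.\<close>
      have "sqrt layer * N\<^sup>2 = ?r * N" "1 / sqrt layer = N / ?r"
        using N_pos r by (simp_all add: layer_def real_sqrt_divide power2_eq_square)
      then have "2 * (sqrt layer * N\<^sup>2) * (?c * \<bar>poly y 1\<bar>) + 1 / sqrt layer * (?Q / 2 * (3/2 * \<bar>poly y 1\<bar>))
         = 2 * (?r * N) * (?c * \<bar>poly y 1\<bar>) + N / ?r * (?Q / 2 * (3/2 * \<bar>poly y 1\<bar>))" by (simp only:)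
      then show ?thesis by (simp add: algebra_simps)
    qed
    also have "\<dots> \<le> N * \<bar>poly y 1\<bar> * (2 * ?c * ?r + ?Q / ?r)"
      using Q r N_pos by (intro mult_left_mono add_left_mono) (auto simp: field_simps)
    finally have fl: "\<bar>flux x\<bar> / sqrt D \<le> N * \<bar>poly y 1\<bar> * (2 * ?c * ?r + ?Q / ?r)" .
    define u v where "u = root_wt x * (N * \<bar>poly y x\<bar>)" and "v = root_wt x * (\<bar>flux x\<bar> / sqrt D)"
    have uv: "u \<ge> 0" "v \<ge> 0" using root_wt_pos[OF x] N_pos D by (auto simp: u_def v_def)
    have e: "energy x = u\<^sup>2 + v\<^sup>2"
      using D unfolding u_def v_def
      by (simp add: energy_def wt_eq D_def power_mult_distrib power_divide algebra_simps)
    have "amplitude \<le> ?G * (u + v)"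
    proof (rule power2_le_imp_le)
      have "amplitude\<^sup>2 \<le> growth_const * energy x"
        using energy_amplitude(2)[OF b(1)] b(2) layer_pos by simp
      also have "energy x \<le> (u + v)\<^sup>2" using uv by (simp add: e power2_sum)
      finally show "amplitude\<^sup>2 \<le> (?G * (u + v))\<^sup>2"
        using growth_const_ge_1 by (simp add: power_mult_distrib)
      show "0 \<le> ?G * (u + v)" using uv growth_const_ge_1 by simp
    qed
    also have "\<dots> \<le> ?G * (root_wt x * (N * \<bar>poly y 1\<bar> * (3/2)) + root_wt x * (N * \<bar>poly y 1\<bar> * (2 * ?c * ?r + ?Q / ?r)))"
      unfolding u_def v_def using near fl root_wt_pos[OF x] N_pos growth_const_ge_1
      by (intro mult_left_mono add_mono) auto
    also have "\<dots> = ?G * (root_wt x * N) * \<bar>poly y 1\<bar> * (3/2 + 2 * ?c * ?r + ?Q / ?r)"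
      by (simp add: algebra_simps)
    also have "\<dots> \<le> ?G * (?r * layer powr (\<alpha> / 2 - 1/4) * ?b) * \<bar>poly y 1\<bar> * (3/2 + 2 * ?c * ?r + ?Q / ?r)"
      unfolding b(4) using b(5) r Q alpha growth_const_ge_1
      by (intro mult_right_mono mult_left_mono add_nonneg_nonneg mult_nonneg_nonneg) auto
    also have "\<dots> = C * \<bar>poly y 1\<bar> * layer powr (\<alpha> / 2 - 1/4)"
      by (simp add: C_def mult_ac)
    also have "\<dots> \<le> max 1 C * \<bar>poly y 1\<bar> * layer powr (\<alpha> / 2 - 1/4)"
      by (intro mult_right_mono) auto
    finally show ?thesis using powr_shift[OF layer_pos] by simp
  qed
  show ?thesis
    by (rule exI[of _ "max 1 C"]) (use * in auto)
qed

lemma layer_reflected: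
  assumes "jacobi_ode \<alpha> \<beta> N y"
  shows "jacobi_ode.layer \<beta> \<alpha> N = jacobi_ode.layer \<alpha> \<beta> N"
proof -
  interpret jacobi_ode \<alpha> \<beta> N y by fact
  interpret R: jacobi_ode \<beta> \<alpha> N "pcompose y [:0, -1:]" by (rule reflected)
  show ?thesis by (simp add: layer_def R.layer_def near_radius_def R.near_radius_def min.commute)
qed

text \<open>The base point 0 of the amplitude is fixed by the reflection, and the flux there merely
  changes sign.\<close>

lemma amplitude_reflected:
  assumes "jacobi_ode \<alpha> \<beta> N y"
  shows "jacobi_ode.amplitude \<beta> \<alpha> N (pcompose y [:0, -1:]) = jacobi_ode.amplitude \<alpha> \<beta> N y"
proof -
  interpret jacobi_ode \<alpha> \<beta> N y by fact
  interpret R: jacobi_ode \<beta> \<alpha> N "pcompose y [:0, -1:]" by (rule reflected)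
  have *: "pderiv [:0, -1 :: real:] = [:-1:]" by (simp add: pderiv_pCons)
  have "R.flux 0 = - flux 0"
    by (simp add: flux_def R.flux_def poly_pcompose pderiv_pcompose * algebra_simps diff_divide_distrib)
  then show ?thesis
    by (simp add: amplitude_def R.amplitude_def energy_def R.energy_def wt_def R.wt_def poly_pcompose)
qed

section \<open>Bounds for the nodal polynomial\<close>

lemma (in jacobi_ode) nodal_reflected:
  shows "poly (jacobi_ode.nodal (pcompose y [:0, -1:])) x = poly nodal (- x)"
    and "poly (pderiv (jacobi_ode.nodal (pcompose y [:0, -1:]))) x = - poly (pderiv nodal) (- x)"
    and "jacobi_ode.dist_right \<beta> \<alpha> N x = dist_left (- x)"
    and "jacobi_ode.dist_left \<beta> \<alpha> N x = dist_right (- x)"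
proof -
  interpret R: jacobi_ode \<beta> \<alpha> N "pcompose y [:0, -1:]" by (rule reflected)
  have *: "pderiv [:0, -1 :: real:] = [:-1:]" by (simp add: pderiv_pCons)
  show "poly R.nodal x = poly nodal (- x)"
    by (simp add: poly_nodal R.poly_nodal poly_pcompose mult_ac)
  show "poly (pderiv R.nodal) x = - poly (pderiv nodal) (- x)"
    by (simp add: poly_pderiv_nodal R.poly_pderiv_nodal poly_pcompose pderiv_pcompose * algebra_simps)
  show "R.dist_right x = dist_left (- x)" "R.dist_left x = dist_right (- x)"
    by (simp_all add: R.dist_right_def R.dist_left_def dist_right_def dist_left_def
        layer_reflected[OF jacobi_ode_axioms])
qed

text \<open>Outside the layer the factor \<open>1 - x\<^sup>2\<close> turns the interior bound into
  the exponents \<open>1 - (\<alpha> / 2 + 1/4)\<close> and \<open>1 - (\<beta> / 2 + 1/4)\<close>,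
  with \<open>1 / N\<close> written as a multiple of \<open>sqrt layer\<close>. Inside,
  \<open>\<bar>y\<bar> \<le> 3/2 * \<bar>y 1\<bar>\<close> and \<open>endpoint_upper\<close> give
  the same powers with \<open>1 - x\<close> replaced by \<open>layer\<close>.\<close>

lemma nodal_upper_right:
  assumes "\<alpha> > -1" "\<beta> > -1"
  shows "\<exists>C>0. \<forall>N y x. jacobi_ode \<alpha> \<beta> N y \<longrightarrow> 0 \<le> x \<longrightarrow> x \<le> 1 \<longrightarrow>
    \<bar>poly (jacobi_ode.nodal y) x\<bar> \<le> C * (jacobi_ode.amplitude \<alpha> \<beta> N y
      * sqrt (jacobi_ode.layer \<alpha> \<beta> N)
      * jacobi_ode.dist_right \<alpha> \<beta> N x powr (3/4 - \<alpha> / 2) * jacobi_ode.dist_left \<alpha> \<beta> N x powr (3/4 - \<beta> / 2))"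
proof -
  let ?G = "sqrt (jacobi_ode.growth_const \<alpha> \<beta>)" and ?r = "sqrt (jacobi_ode.near_radius \<alpha> \<beta>)"
  let ?b = "2 powr \<bar>3/4 - \<beta> / 2\<bar>"
  obtain C1 where C1: "C1 > 0" "\<And>N y. jacobi_ode \<alpha> \<beta> N y \<Longrightarrow>
    \<bar>poly y 1\<bar> \<le> C1 * jacobi_ode.amplitude \<alpha> \<beta> N y * jacobi_ode.layer \<alpha> \<beta> N powr (1/4 - \<alpha> / 2)"
    using endpoint_upper[OF assms] by blast
  define C where "C = max (?G / ?r) (3 * C1 * ?b)"
  have "\<bar>poly (jacobi_ode.nodal y) x\<bar> \<le> C * (jacobi_ode.amplitude \<alpha> \<beta> N y
      * sqrt (jacobi_ode.layer \<alpha> \<beta> N)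
      * jacobi_ode.dist_right \<alpha> \<beta> N x powr (3/4 - \<alpha> / 2) * jacobi_ode.dist_left \<alpha> \<beta> N x powr (3/4 - \<beta> / 2))"
    if "jacobi_ode \<alpha> \<beta> N y" and x: "0 \<le> x" "x \<le> 1" for N y x
  proof -
    interpret jacobi_ode \<alpha> \<beta> N y by fact
    define P where "P = amplitude * sqrt layer * dist_right x powr (3/4 - \<alpha> / 2) * dist_left x powr (3/4 - \<beta> / 2)"
    have P: "P \<ge> 0" using amplitude_nonneg layer_pos by (simp add: P_def)
    have dl: "dist_left x = 1 + x" using layer_le_1 x by (simp add: dist_left_def)
    have r: "?r > 0" using near_radius_pos by simp
    have "\<bar>poly nodal x\<bar> \<le> ?G / ?r * P \<or> \<bar>poly nodal x\<bar> \<le> 3 * C1 * ?b * P"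
    proof (cases "layer \<le> 1 - x")
      case True
      then have dr: "dist_right x = 1 - x" by (simp add: dist_right_def)
      have x1: "-1 < x" "x < 1" using x True layer_pos by auto
      have "layer * 1 \<le> (1 - x) * (1 + x)" using True x layer_pos by (intro mult_mono) auto
      then have "layer / 4 \<le> 1 - x\<^sup>2" using layer_pos by (simp add: power2_eq_square algebra_simps)
      from interior_bounds(1)[OF _ this] have "root_wt x * (N * \<bar>poly y x\<bar>) \<le> ?G * amplitude"
        using x1 by auto
      then have "root_wt x * (N * \<bar>poly y x\<bar>) * (1 / N) \<le> ?G * amplitude * (1 / N)"
        using N_pos by (intro mult_right_mono) auto
      moreover have "1 / N = sqrt layer / ?r"
        using N_pos near_radius_pos by (simp add: layer_def real_sqrt_divide)
      moreover have "root_wt x * (N * \<bar>poly y x\<bar>) * (1 / N) = root_wt x * \<bar>poly y x\<bar>" using N_pos by simp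
      ultimately have 1: "root_wt x * \<bar>poly y x\<bar> \<le> ?G * amplitude * (sqrt layer / ?r)" by (simp only:)
      have split: "t powr (3/4 - c / 2) * t powr (c / 2 + 1/4) = t" if "t > 0" for t c :: real
        using that by (simp flip: powr_add)
      have "(1 - x) powr (3/4 - \<alpha> / 2) * (1 + x) powr (3/4 - \<beta> / 2) * (root_wt x * \<bar>poly y x\<bar>)
         = ((1 - x) powr (3/4 - \<alpha> / 2) * (1 - x) powr (\<alpha> / 2 + 1/4))
           * ((1 + x) powr (3/4 - \<beta> / 2) * (1 + x) powr (\<beta> / 2 + 1/4)) * \<bar>poly y x\<bar>"
        unfolding root_wt_def by (simp only: mult_ac)
      also have "\<dots> = \<bar>poly nodal x\<bar>"
        using x1 split[of "1 - x" \<alpha>] split[of "1 + x" \<beta>] by (simp add: poly_nodal abs_mult)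
      finally have "\<bar>poly nodal x\<bar> = (1 - x) powr (3/4 - \<alpha> / 2) * (1 + x) powr (3/4 - \<beta> / 2) * (root_wt x * \<bar>poly y x\<bar>)"
        by (rule sym)
      also have "\<dots> \<le> (1 - x) powr (3/4 - \<alpha> / 2) * (1 + x) powr (3/4 - \<beta> / 2) * (?G * amplitude * (sqrt layer / ?r))"
        using 1 by (intro mult_left_mono) auto
      also have "\<dots> = ?G / ?r * P" by (simp add: P_def dr dl)
      finally show ?thesis by simp
    next
      case False
      then have dr: "dist_right x = layer" by (simp add: dist_right_def)
      have "\<bar>poly y x - poly y 1\<bar> \<le> \<bar>poly y 1\<bar> / 2" using near_one(1)[of x] False x by simp
      then have "\<bar>poly y x\<bar> \<le> 3/2 * \<bar>poly y 1\<bar>" by linarith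
      also have "\<dots> \<le> 3/2 * (C1 * amplitude * layer powr (1/4 - \<alpha> / 2))"
        using C1(2)[OF \<open>jacobi_ode \<alpha> \<beta> N y\<close>] by simp
      finally have y: "\<bar>poly y x\<bar> \<le> 3/2 * (C1 * amplitude * layer powr (1/4 - \<alpha> / 2))" .
      have "\<bar>poly nodal x\<bar> = ((1 - x) * (1 + x)) * \<bar>poly y x\<bar>" using x by (simp add: poly_nodal abs_mult)
      also have "\<dots> \<le> (layer * 2) * (3/2 * (C1 * amplitude * layer powr (1/4 - \<alpha> / 2)))"
        using y x False layer_pos by (intro mult_mono) auto
      also have "\<dots> = 3 * C1 * amplitude * (layer powr 1 * layer powr (1/4 - \<alpha> / 2))"
        using layer_pos by simp
      also have "layer powr 1 * layer powr (1/4 - \<alpha> / 2) = sqrt layer * layer powr (3/4 - \<alpha> / 2)"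
        using layer_pos unfolding powr_half_sqrt[OF less_imp_le[OF layer_pos], symmetric] powr_add[symmetric]
        by (simp add: algebra_simps)
      also have "3 * C1 * amplitude * (sqrt layer * layer powr (3/4 - \<alpha> / 2)) * 1
          \<le> 3 * C1 * amplitude * (sqrt layer * layer powr (3/4 - \<alpha> / 2)) * (?b * (1 + x) powr (3/4 - \<beta> / 2))"
      proof (rule mult_left_mono)
        have "1 powr (3/4 - \<beta> / 2) \<le> ?b * (1 + x) powr (3/4 - \<beta> / 2)"
          using x by (intro powr_comparable) auto
        then show "1 \<le> ?b * (1 + x) powr (3/4 - \<beta> / 2)" by simp
      qed (use amplitude_nonneg C1(1) layer_pos in auto)
      finally show ?thesis by (simp add: P_def dr dl mult_ac)
    qed
    moreover have "?G / ?r * P \<le> C * P" by (rule mult_right_mono[OF _ P]) (simp add: C_def)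
    moreover have "3 * C1 * ?b * P \<le> C * P" by (rule mult_right_mono[OF _ P]) (simp add: C_def)
    ultimately show ?thesis unfolding P_def[symmetric] by linarith
  qed
  moreover have "C > 0" using C1(1) by (simp add: C_def less_max_iff_disj)
  ultimately show ?thesis by blast
qed

lemma nodal_upper:
  assumes "\<alpha> > -1" "\<beta> > -1"
  shows "\<exists>C>0. \<forall>N y x. jacobi_ode \<alpha> \<beta> N y \<longrightarrow> \<bar>x\<bar> \<le> 1 \<longrightarrow>
    \<bar>poly (jacobi_ode.nodal y) x\<bar> \<le> C * (jacobi_ode.amplitude \<alpha> \<beta> N y
      * sqrt (jacobi_ode.layer \<alpha> \<beta> N)
      * jacobi_ode.dist_right \<alpha> \<beta> N x powr (3/4 - \<alpha> / 2) * jacobi_ode.dist_left \<alpha> \<beta> N x powr (3/4 - \<beta> / 2))"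
proof -
  obtain C1 where C1: "C1 > 0" "\<And>N y x. jacobi_ode \<alpha> \<beta> N y \<Longrightarrow> 0 \<le> x \<Longrightarrow> x \<le> 1 \<Longrightarrow>
    \<bar>poly (jacobi_ode.nodal y) x\<bar> \<le> C1 * (jacobi_ode.amplitude \<alpha> \<beta> N y
      * sqrt (jacobi_ode.layer \<alpha> \<beta> N)
      * jacobi_ode.dist_right \<alpha> \<beta> N x powr (3/4 - \<alpha> / 2) * jacobi_ode.dist_left \<alpha> \<beta> N x powr (3/4 - \<beta> / 2))"
    using nodal_upper_right[OF assms] by blast
  obtain C2 where C2: "C2 > 0" "\<And>N y x. jacobi_ode \<beta> \<alpha> N y \<Longrightarrow> 0 \<le> x \<Longrightarrow> x \<le> 1 \<Longrightarrow>
    \<bar>poly (jacobi_ode.nodal y) x\<bar> \<le> C2 * (jacobi_ode.amplitude \<beta> \<alpha> N y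
      * sqrt (jacobi_ode.layer \<beta> \<alpha> N)
      * jacobi_ode.dist_right \<beta> \<alpha> N x powr (3/4 - \<beta> / 2) * jacobi_ode.dist_left \<beta> \<alpha> N x powr (3/4 - \<alpha> / 2))"
    using nodal_upper_right[OF assms(2,1)] by blast
  have "\<bar>poly (jacobi_ode.nodal y) x\<bar> \<le> max C1 C2 * (jacobi_ode.amplitude \<alpha> \<beta> N y
      * sqrt (jacobi_ode.layer \<alpha> \<beta> N)
      * jacobi_ode.dist_right \<alpha> \<beta> N x powr (3/4 - \<alpha> / 2) * jacobi_ode.dist_left \<alpha> \<beta> N x powr (3/4 - \<beta> / 2))"
    if J: "jacobi_ode \<alpha> \<beta> N y" and x: "\<bar>x\<bar> \<le> 1" for N y x
  proof -
    interpret jacobi_ode \<alpha> \<beta> N y by fact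
    define P where "P = amplitude * sqrt layer * dist_right x powr (3/4 - \<alpha> / 2) * dist_left x powr (3/4 - \<beta> / 2)"
    have P: "P \<ge> 0" using amplitude_nonneg layer_pos by (simp add: P_def)
    have "\<bar>poly nodal x\<bar> \<le> C1 * P \<or> \<bar>poly nodal x\<bar> \<le> C2 * P"
    proof (cases "x \<ge> 0")
      case True
      then show ?thesis using C1(2)[OF J] x by (simp add: P_def)
    next
      case False
      then show ?thesis using C2(2)[OF reflected, of "-x"] x
        by (simp add: P_def nodal_reflected amplitude_reflected[OF J] layer_reflected[OF J] mult_ac)
    qed
    moreover have "C1 * P \<le> max C1 C2 * P" "C2 * P \<le> max C1 C2 * P"
      using P by (auto intro!: mult_right_mono)
    ultimately show ?thesis unfolding P_def[symmetric] by linarith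
  qed
  moreover have "max C1 C2 > 0" using C1(1) by simp
  ultimately show ?thesis by blast
qed

lemma (in jacobi_ode) endpoint_nonzero:
  assumes "y \<noteq> 0"
  shows "poly y 1 \<noteq> 0"
proof
  assume "poly y 1 = 0"
  then have "poly y x = 0" if "x \<in> {1 - layer..1}" for x
    using near_one(1)[of x] that by simp
  then have "{1 - layer..1} \<subseteq> {x. poly y x = 0}" by auto
  moreover have "infinite {1 - layer..1}" using layer_pos by simp
  ultimately show False using poly_roots_finite[OF assms] finite_subset by blast
qed

text \<open>Inside the layer \<open>\<bar>y\<bar>\<close> keeps at least half of its nonzero
  endpoint value. Hence interior nodes of the right half lie where \<open>root_deriv_bound\<close>
  applies, and their \<open>dist_right\<close> is the true distance.\<close>

lemma (in jacobi_ode) root_outside_layer: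
  assumes "y \<noteq> 0" "poly y z = 0" "z \<le> 1"
  shows "layer < 1 - z"
proof (rule ccontr)
  assume "\<not> layer < 1 - z"
  then have "\<bar>poly y z - poly y 1\<bar> \<le> \<bar>poly y 1\<bar> / 2" using near_one(1)[of z] assms by simp
  then show False using assms endpoint_nonzero by simp
qed

text \<open>At an interior node the derivative is \<open>(1 - z\<^sup>2)\<close> times that of
  \<open>y\<close>, and \<open>root_deriv_bound\<close> applies; at \<open>z = 1\<close> it is
  \<open>- 2\<close> times \<open>y 1\<close>, and \<open>endpoint_lower\<close> applies. Both give
  the same power of the cut-off distance. For \<open>z \<ge> 0\<close> the power of
  \<open>1 + z\<close> goes into the constant.\<close>

lemma nodal_deriv_lower:
  assumes "\<alpha> > -1" "\<beta> > -1"
  shows "\<exists>C>0. \<forall>N y z. jacobi_ode \<alpha> \<beta> N y \<longrightarrow> y \<noteq> 0 \<longrightarrow> 0 \<le> z \<longrightarrow> z \<le> 1 \<longrightarrow> poly (jacobi_ode.nodal y) z = 0 \<longrightarrow>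
    jacobi_ode.amplitude \<alpha> \<beta> N y * jacobi_ode.dist_right \<alpha> \<beta> N z powr (1/4 - \<alpha> / 2)
      \<le> C * \<bar>poly (pderiv (jacobi_ode.nodal y)) z\<bar>"
proof -
  let ?G = "sqrt (jacobi_ode.growth_const \<alpha> \<beta>)"
  let ?b = "2 powr \<bar>\<beta> / 2 - 1/4\<bar>"
  obtain C1 where C1: "C1 > 0" "\<And>N y. jacobi_ode \<alpha> \<beta> N y \<Longrightarrow>
    jacobi_ode.amplitude \<alpha> \<beta> N y * jacobi_ode.layer \<alpha> \<beta> N powr (1/4 - \<alpha> / 2) \<le> C1 * \<bar>poly y 1\<bar>"
    using endpoint_lower[OF assms] by blast
  define C where "C = max C1 (?G * ?b)"
  have "jacobi_ode.amplitude \<alpha> \<beta> N y * jacobi_ode.dist_right \<alpha> \<beta> N z powr (1/4 - \<alpha> / 2)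
      \<le> C * \<bar>poly (pderiv (jacobi_ode.nodal y)) z\<bar>"
    if J: "jacobi_ode \<alpha> \<beta> N y" and "y \<noteq> 0" and z: "0 \<le> z" "z \<le> 1" and node: "poly (jacobi_ode.nodal y) z = 0" for N y z
  proof -
    interpret jacobi_ode \<alpha> \<beta> N y by fact
    show ?thesis
    proof (cases "z = 1")
      case True
      have "dist_right z = layer" using True layer_pos by (simp add: dist_right_def)
      then have "amplitude * dist_right z powr (1/4 - \<alpha> / 2) \<le> C1 * \<bar>poly y 1\<bar>" using C1(2)[OF J] by simp
      also have "\<dots> \<le> C * (2 * \<bar>poly y 1\<bar>)" using C1(1) by (intro mult_mono) (auto simp: C_def)
      also have "2 * \<bar>poly y 1\<bar> = \<bar>poly (pderiv nodal) z\<bar>" using True by (simp add: poly_pderiv_nodal)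
      finally show ?thesis .
    next
      case False
      then have z1: "-1 < z" "z < 1" using z by auto
      have root: "poly y z = 0" using node z1 by (simp add: poly_nodal)
      have out: "layer < 1 - z" using root_outside_layer[OF \<open>y \<noteq> 0\<close> root] z by simp
      then have dr: "dist_right z = 1 - z" by (simp add: dist_right_def)
      have "layer * 1 \<le> (1 - z) * (1 + z)" using out z layer_pos by (intro mult_mono) auto
      then have D: "layer / 4 \<le> 1 - z\<^sup>2" using layer_pos by (simp add: power2_eq_square algebra_simps)
      have e: "1 - z\<^sup>2 = (1 - z) * (1 + z)" by (simp add: power2_eq_square algebra_simps)
      have half: "t powr (c / 2 + 1/4) * sqrt t = t powr (c / 2 - 1/4) * t" if "t > 0" for t c :: real
      proof -
        have "t powr (c / 2 + 1/4) * t powr (1/2) = t powr (c / 2 - 1/4) * t powr 1"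
          unfolding powr_add[symmetric] by (simp add: algebra_simps)
        then show ?thesis using that by (simp add: powr_half_sqrt)
      qed
      have "root_wt z * (sqrt (1 - z\<^sup>2) * \<bar>poly (pderiv y) z\<bar>)
         = ((1 - z) powr (\<alpha> / 2 + 1/4) * sqrt (1 - z)) * ((1 + z) powr (\<beta> / 2 + 1/4) * sqrt (1 + z)) * \<bar>poly (pderiv y) z\<bar>"
        unfolding root_wt_def e real_sqrt_mult by (simp add: mult_ac)
      also have "\<dots> = (1 - z) powr (\<alpha> / 2 - 1/4) * (1 + z) powr (\<beta> / 2 - 1/4) * ((1 - z) * (1 + z) * \<bar>poly (pderiv y) z\<bar>)"
        using z1 by (subst half, simp, subst half) (simp_all add: mult_ac)
      also have "(1 - z) * (1 + z) * \<bar>poly (pderiv y) z\<bar> = \<bar>poly (pderiv nodal) z\<bar>"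
        using z1 by (simp add: poly_pderiv_nodal root e abs_mult)
      finally have "amplitude \<le> ?G * ((1 - z) powr (\<alpha> / 2 - 1/4) * (1 + z) powr (\<beta> / 2 - 1/4) * \<bar>poly (pderiv nodal) z\<bar>)"
        using root_deriv_bound[OF _ D root] z1 by auto
      also have "\<dots> \<le> ?G * ((1 - z) powr (\<alpha> / 2 - 1/4) * ?b * \<bar>poly (pderiv nodal) z\<bar>)"
      proof -
        have "(1 + z) powr (\<beta> / 2 - 1/4) \<le> ?b * 1 powr (\<beta> / 2 - 1/4)"
          using z by (intro powr_comparable) auto
        then show ?thesis using growth_const_ge_1 by (intro mult_left_mono mult_right_mono) auto
      qed
      also have "\<dots> \<le> C * \<bar>poly (pderiv nodal) z\<bar> * (1 - z) powr (\<alpha> / 2 - 1/4)"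
      proof -
        have "?G * ?b * (\<bar>poly (pderiv nodal) z\<bar> * (1 - z) powr (\<alpha> / 2 - 1/4))
            \<le> C * (\<bar>poly (pderiv nodal) z\<bar> * (1 - z) powr (\<alpha> / 2 - 1/4))"
          by (intro mult_right_mono) (auto simp: C_def)
        then show ?thesis by (simp add: mult_ac)
      qed
      finally have "amplitude \<le> C * \<bar>poly (pderiv nodal) z\<bar> * (1 - z) powr (\<alpha> / 2 - 1/4)" .
      then show ?thesis using powr_shift[of "1 - z"] z1 dr by simp
    qed
  qed
  moreover have "C > 0" using C1(1) by (simp add: C_def less_max_iff_disj)
  ultimately show ?thesis by blast
qed

text \<open>The mean value theorem, applied to \<open>y\<close> rather than to the nodal polynomial,
  supplies the factor \<open>\<bar>x - z\<bar>\<close>. Staying within half of the distance from the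
  node to 1 keeps \<open>1 - \<xi>\<close> comparable to \<open>1 - z\<close>. For
  \<open>z = 1\<close> the factor is already present in \<open>1 - x\<^sup>2\<close>, and
  \<open>x\<close> lies in the layer.\<close>

lemma nodal_near:
  assumes "\<alpha> > -1" "\<beta> > -1"
  shows "\<exists>C>0. \<forall>N y z x. jacobi_ode \<alpha> \<beta> N y \<longrightarrow> y \<noteq> 0 \<longrightarrow> 0 \<le> z \<longrightarrow> z \<le> 1 \<longrightarrow> poly (jacobi_ode.nodal y) z = 0 \<longrightarrow>
    \<bar>x\<bar> \<le> 1 \<longrightarrow> \<bar>x - z\<bar> < jacobi_ode.dist_right \<alpha> \<beta> N z / 2 \<longrightarrow>
    \<bar>poly (jacobi_ode.nodal y) x\<bar> \<le> C * (\<bar>x - z\<bar> * \<bar>poly (pderiv (jacobi_ode.nodal y)) z\<bar>)"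
proof -
  define G where "G = sqrt (jacobi_ode.growth_const \<alpha> \<beta>) * (1 + jacobi_ode.coeff_bound \<alpha> \<beta> / sqrt (jacobi_ode.near_radius \<alpha> \<beta>))"
  let ?a = "2 powr \<bar>- (\<alpha> / 2 + 3/4)\<bar>"
  let ?b = "2 powr \<bar>- (\<beta> / 2 + 3/4)\<bar>"
  obtain C1 where C1: "C1 > 0" "\<And>N y z. jacobi_ode \<alpha> \<beta> N y \<Longrightarrow> y \<noteq> 0 \<Longrightarrow> 0 \<le> z \<Longrightarrow> z \<le> 1 \<Longrightarrow> poly (jacobi_ode.nodal y) z = 0 \<Longrightarrow>
    jacobi_ode.amplitude \<alpha> \<beta> N y * jacobi_ode.dist_right \<alpha> \<beta> N z powr (1/4 - \<alpha> / 2)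
      \<le> C1 * \<bar>poly (pderiv (jacobi_ode.nodal y)) z\<bar>"
    using nodal_deriv_lower[OF assms] by blast
  define C where "C = max (3/2) (3 * (G * ?a * ?b * C1))"
  have "\<bar>poly (jacobi_ode.nodal y) x\<bar> \<le> C * (\<bar>x - z\<bar> * \<bar>poly (pderiv (jacobi_ode.nodal y)) z\<bar>)"
    if J: "jacobi_ode \<alpha> \<beta> N y" and "y \<noteq> 0" and z: "0 \<le> z" "z \<le> 1" and node: "poly (jacobi_ode.nodal y) z = 0"
      and x: "\<bar>x\<bar> \<le> 1" "\<bar>x - z\<bar> < jacobi_ode.dist_right \<alpha> \<beta> N z / 2" for N y z x
  proof -
    interpret jacobi_ode \<alpha> \<beta> N y by fact
    have "G \<ge> 0" using growth_const_ge_1 near_radius_pos by (simp add: G_def coeff_bound_def)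
    define P where "P = \<bar>x - z\<bar> * \<bar>poly (pderiv nodal) z\<bar>"
    have P: "P \<ge> 0" by (simp add: P_def)
    have "\<bar>poly nodal x\<bar> \<le> 3/2 * P \<or> \<bar>poly nodal x\<bar> \<le> 3 * (G * ?a * ?b * C1) * P"
    proof (cases "z = 1")
      case True
      have "dist_right z = layer" using True layer_pos by (simp add: dist_right_def)
      then have "1 - layer \<le> x" using x True layer_pos by auto
      then have "\<bar>poly y x - poly y 1\<bar> \<le> \<bar>poly y 1\<bar> / 2" using near_one(1)[of x] x by simp
      then have y: "\<bar>poly y x\<bar> \<le> 3/2 * \<bar>poly y 1\<bar>" by linarith
      have "\<bar>poly nodal x\<bar> = (\<bar>x - z\<bar> * (1 + x)) * \<bar>poly y x\<bar>"
        using x True by (simp add: poly_nodal abs_mult abs_minus_commute)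
      also have "\<dots> \<le> (\<bar>x - z\<bar> * 2) * (3/2 * \<bar>poly y 1\<bar>)"
        using y x by (intro mult_mono) auto
      also have "\<dots> = 3/2 * P" using True by (simp add: P_def poly_pderiv_nodal abs_mult)
      finally show ?thesis by simp
    next
      case False
      then have z1: "-1 < z" "z < 1" using z by auto
      have root: "poly y z = 0" using node z1 by (simp add: poly_nodal)
      have out: "layer < 1 - z" using root_outside_layer[OF \<open>y \<noteq> 0\<close> root] z by simp
      then have dr: "dist_right z = 1 - z" by (simp add: dist_right_def)
      obtain \<xi> where \<xi>: "\<bar>\<xi> - z\<bar> \<le> \<bar>x - z\<bar>" "\<bar>poly y x\<bar> = \<bar>x - z\<bar> * \<bar>poly (pderiv y) \<xi>\<bar>"
      proof (cases x z rule: linorder_cases)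
        case less
        from poly_MVT[OF this, of y] obtain \<xi> where "x < \<xi>" "\<xi> < z"
          "poly y z - poly y x = (z - x) * poly (pderiv y) \<xi>" by auto
        then have "poly y x = (x - z) * poly (pderiv y) \<xi>" using root by (simp add: algebra_simps)
        then show ?thesis using that[of \<xi>] \<open>x < \<xi>\<close> \<open>\<xi> < z\<close> by (auto simp: abs_mult)
      next
        case equal
        then show ?thesis using that[of z] root by auto
      next
        case greater
        from poly_MVT[OF this, of y] obtain \<xi> where "z < \<xi>" "\<xi> < x"
          "poly y x - poly y z = (x - z) * poly (pderiv y) \<xi>" by auto
        then show ?thesis using that[of \<xi>] root by (auto simp: abs_mult)
      qed
      have d: "\<bar>\<xi> - z\<bar> \<le> (1 - z) / 2" "\<bar>x - z\<bar> \<le> (1 - z) / 2" using \<xi> x dr by auto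
      note d1 = abs_le_D1[OF d(1)] abs_le_D2[OF d(1)] abs_le_D2[OF d(2)]
      have \<xi>b: "(1 - z) / 2 \<le> 1 - \<xi>" "1 - \<xi> \<le> 2 * (1 - z)" "1/2 \<le> 1 + \<xi>" "1 + \<xi> \<le> 2" "-1 < \<xi>" "\<xi> < 1"
        using d1(1,2) z1 z by (simp_all add: field_simps)
      have xb: "1 - x \<le> 3/2 * (1 - z)" using d1(3) by (simp add: field_simps)
      have e: "1 - \<xi>\<^sup>2 = (1 - \<xi>) * (1 + \<xi>)" by (simp add: power2_eq_square algebra_simps)
      have "layer / 4 \<le> (1 - z) / 2 * (1/2)" using out by simp
      also have "\<dots> \<le> (1 - \<xi>) * (1 + \<xi>)" using \<xi>b z1 by (intro mult_mono) auto
      finally have D: "layer / 4 \<le> 1 - \<xi>\<^sup>2" by (simp add: e)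
      have quarter: "t powr (c / 2 + 1/4) * sqrt t = t powr (c / 2 + 3/4)" if "t > 0" for t c :: real
        using that by (simp add: powr_half_sqrt[symmetric] add.commute flip: powr_add)
      have "root_wt \<xi> * (sqrt (1 - \<xi>\<^sup>2) * \<bar>poly (pderiv y) \<xi>\<bar>)
         = ((1 - \<xi>) powr (\<alpha> / 2 + 1/4) * sqrt (1 - \<xi>)) * ((1 + \<xi>) powr (\<beta> / 2 + 1/4) * sqrt (1 + \<xi>)) * \<bar>poly (pderiv y) \<xi>\<bar>"
        unfolding root_wt_def e real_sqrt_mult by (simp add: mult_ac)
      also have "\<dots> = (1 - \<xi>) powr (\<alpha> / 2 + 3/4) * (1 + \<xi>) powr (\<beta> / 2 + 3/4) * \<bar>poly (pderiv y) \<xi>\<bar>"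
        using \<xi>b by (simp add: quarter)
      finally have eq: "root_wt \<xi> * (sqrt (1 - \<xi>\<^sup>2) * \<bar>poly (pderiv y) \<xi>\<bar>)
         = (1 - \<xi>) powr (\<alpha> / 2 + 3/4) * (1 + \<xi>) powr (\<beta> / 2 + 3/4) * \<bar>poly (pderiv y) \<xi>\<bar>" .
      have "\<bar>\<xi>\<bar> < 1" using \<xi>b by (simp add: abs_less_iff)
      from interior_bounds(2)[OF this D]
      have "(1 - \<xi>) powr (\<alpha> / 2 + 3/4) * (1 + \<xi>) powr (\<beta> / 2 + 3/4) * \<bar>poly (pderiv y) \<xi>\<bar> \<le> G * amplitude"
        unfolding eq G_def[symmetric] .
      then have "\<bar>poly (pderiv y) \<xi>\<bar> * (1 + \<xi>) powr (\<beta> / 2 + 3/4) * (1 - \<xi>) powr (\<alpha> / 2 + 3/4) \<le> G * amplitude"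
        by (simp add: mult_ac)
      then have "\<bar>poly (pderiv y) \<xi>\<bar> \<le> G * amplitude * (1 - \<xi>) powr (- (\<alpha> / 2 + 3/4)) * (1 + \<xi>) powr (- (\<beta> / 2 + 3/4))"
        using powr_shift'[of "1 - \<xi>"] powr_shift'[of "1 + \<xi>"] \<xi>b by simp
      also have "\<dots> \<le> G * amplitude * (?a * (1 - z) powr (- (\<alpha> / 2 + 3/4))) * (?b * 1 powr (- (\<beta> / 2 + 3/4)))"
        using \<xi>b z1 \<open>G \<ge> 0\<close> amplitude_nonneg
        by (intro mult_mono mult_left_mono powr_comparable mult_nonneg_nonneg) auto
      finally have y': "\<bar>poly (pderiv y) \<xi>\<bar> \<le> G * ?a * ?b * amplitude * (1 - z) powr (- (\<alpha> / 2 + 3/4))"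
        by (simp add: mult_ac)
      have "\<bar>poly nodal x\<bar> = ((1 - x) * (1 + x)) * \<bar>poly y x\<bar>" using x by (simp add: poly_nodal abs_mult)
      also have "\<dots> \<le> (3/2 * (1 - z) * 2) * (\<bar>x - z\<bar> * (G * ?a * ?b * amplitude * (1 - z) powr (- (\<alpha> / 2 + 3/4))))"
        unfolding \<xi>(2) using x xb y' z1 by (intro mult_mono mult_left_mono) auto
      also have "\<dots> = 3 * (G * ?a * ?b) * \<bar>x - z\<bar> * (amplitude * ((1 - z) powr 1 * (1 - z) powr (- (\<alpha> / 2 + 3/4))))"
        using z1 by simp
      \<comment> \<open>The factor \<open>1 - x\<close> of the nodal polynomial raises the exponent
        by 1 to exactly that of \<open>nodal_deriv_lower\<close>.\<close>
      also have "(1 - z) powr 1 * (1 - z) powr (- (\<alpha> / 2 + 3/4)) = dist_right z powr (1/4 - \<alpha> / 2)"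
        unfolding powr_add[symmetric] dr by (simp add: algebra_simps)
      also have "3 * (G * ?a * ?b) * \<bar>x - z\<bar> * (amplitude * dist_right z powr (1/4 - \<alpha> / 2))
          \<le> 3 * (G * ?a * ?b) * \<bar>x - z\<bar> * (C1 * \<bar>poly (pderiv nodal) z\<bar>)"
        using C1(2)[OF J \<open>y \<noteq> 0\<close> z node] \<open>G \<ge> 0\<close> by (intro mult_left_mono mult_nonneg_nonneg) auto
      also have "\<dots> = 3 * (G * ?a * ?b * C1) * P" by (simp add: P_def)
      finally show ?thesis by simp
    qed
    moreover have "3/2 * P \<le> C * P" by (rule mult_right_mono[OF _ P]) (simp add: C_def)
    moreover have "3 * (G * ?a * ?b * C1) * P \<le> C * P" by (rule mult_right_mono[OF _ P]) (simp add: C_def)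
    ultimately show ?thesis unfolding P_def[symmetric] by linarith
  qed
  moreover have "C > 0" by (simp add: C_def less_max_iff_disj)
  ultimately show ?thesis by blast
qed

section \<open>Power inequalities that produce the exponents\<close>

lemma powr_le_two_powr:
  fixes t e :: real
  assumes "1/2 \<le> t" "t \<le> 2"
  shows "t powr e \<le> 2 powr \<bar>e\<bar>"
  using powr_comparable[of 1 t e] assms by simp

lemma mult3_mono:
  fixes a b c :: real
  assumes "a \<le> a'" "b \<le> b'" "c \<le> c'" "0 \<le> a" "0 \<le> b" "0 \<le> c"
  shows "a * b * c \<le> a' * b' * c'"
  using assms by (intro mult_mono mult_nonneg_nonneg) auto

lemma powr_exponent_antimono:
  fixes l :: real
  assumes "0 < l" "l \<le> 1" "b \<le> a"
  shows "l powr a \<le> l powr b"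
  using assms by (intro powr_mono') auto

text \<open>Here \<open>A\<close> and \<open>B\<close> stand for the cut-off distances of
  \<open>x\<close> and of the node from 1. Both \<open>max A B\<close> and the product on the left
  are homogeneous of degree 1 in \<open>l\<close>, \<open>A\<close>, \<open>B\<close>, and after
  division each variable can be moved monotonically. \<open>A\<close> of order 1 with
  \<open>B = l\<close> gives the power \<open>1 - p\<close> of \<open>l\<close> when
  \<open>p > 1\<close>; \<open>A = l\<close> with \<open>B\<close> of order 1 gives
  \<open>1/2 + p\<close> when \<open>p < -1/2\<close>. Otherwise the quotient is at most 1.\<close>

lemma same_side_bound:
  fixes l A B p \<mu> :: real
  assumes l: "0 < l" "l \<le> 1" and A: "l \<le> A" "A \<le> 2" and B: "l \<le> B" "B \<le> 2"
    and \<mu>: "0 \<le> \<mu>" "p - 1 \<le> \<mu>" "- 1/2 - p \<le> \<mu>"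
  shows "sqrt l * A powr p * B powr (1/2 - p) \<le> 2 powr (\<bar>p\<bar> + 1) * l powr (- \<mu>) * max A B"
proof -
  have pos: "A > 0" "B > 0" using l A B by auto
  have l\<mu>: "l powr e \<le> l powr (- \<mu>)" if "- \<mu> \<le> e" for e
    using powr_exponent_antimono[OF l that] .
  have l0: "1 \<le> l powr (- \<mu>)" using l\<mu>[of 0] \<mu> l by simp
  have two: "2 powr e \<le> 2 powr (\<bar>p\<bar> + 1)" if "e \<le> \<bar>p\<bar> + 1" for e :: real
    using that by (intro powr_mono) auto
  have two0: "1 \<le> 2 powr (\<bar>p\<bar> + 1)" using two[of 0] by simp
  have one: "1 \<le> 2 powr (\<bar>p\<bar> + 1) * l powr (- \<mu>)"
    using mult_mono[OF two0 l0] by simp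
  show ?thesis
  proof (cases "B \<le> A")
    case True
    have "l powr (1/2) * A powr (p - 1) * B powr (1/2 - p) \<le> 2 powr (\<bar>p\<bar> + 1) * l powr (- \<mu>)"
    proof (cases "p \<le> 1")
      case p: True
      have "l powr (1/2) * A powr (p - 1) * B powr (1/2 - p) \<le> B powr (1/2) * B powr (p - 1) * B powr (1/2 - p)"
        using l B True pos p by (intro mult3_mono[OF powr_mono2 powr_mono2' order_refl]) auto
      also have "\<dots> = 1" using pos by (simp flip: powr_add)
      finally show ?thesis using one by linarith
    next
      case False
      have "l powr (1/2) * A powr (p - 1) * B powr (1/2 - p) \<le> l powr (1/2) * 2 powr (p - 1) * l powr (1/2 - p)"
        using l A B pos False by (intro mult3_mono[OF order_refl powr_mono2 powr_mono2']) auto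
      also have "\<dots> = 2 powr (p - 1) * l powr (1 - p)" using l by (simp add: mult_ac flip: powr_add)
      also have "\<dots> \<le> 2 powr (\<bar>p\<bar> + 1) * l powr (- \<mu>)"
        using \<mu> by (intro mult_mono two l\<mu>) auto
      finally show ?thesis .
    qed
    then have "l powr (1/2) * A powr (p - 1) * B powr (1/2 - p) * A \<le> 2 powr (\<bar>p\<bar> + 1) * l powr (- \<mu>) * A"
      using pos by (intro mult_right_mono) auto
    moreover have "A powr p = A powr (p - 1) * A" using pos by (simp add: powr_diff)
    ultimately show ?thesis using True l by (simp add: powr_half_sqrt mult_ac)
  next
    case False
    have "l powr (1/2) * A powr p * B powr (- 1/2 - p) \<le> 2 powr (\<bar>p\<bar> + 1) * l powr (- \<mu>)"
    proof -
      consider "p \<ge> 0" | "p < 0" "- 1/2 \<le> p" | "p < - 1/2" by linarith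
      then show ?thesis
      proof cases
        case 1
        have "l powr (1/2) * A powr p * B powr (- 1/2 - p) \<le> B powr (1/2) * B powr p * B powr (- 1/2 - p)"
          using l B False pos 1 by (intro mult3_mono[OF powr_mono2 powr_mono2 order_refl]) auto
        also have "\<dots> = 1" using pos by (simp flip: powr_add)
        finally show ?thesis using one by linarith
      next
        case 2
        have "l powr (1/2) * A powr p * B powr (- 1/2 - p) \<le> l powr (1/2) * l powr p * l powr (- 1/2 - p)"
          using l A B False pos 2 by (intro mult3_mono[OF order_refl powr_mono2' powr_mono2']) auto
        also have "\<dots> = 1" using l by (simp flip: powr_add)
        finally show ?thesis using one by linarith
      next
        case 3
        have "l powr (1/2) * A powr p * B powr (- 1/2 - p) \<le> l powr (1/2) * l powr p * 2 powr (- 1/2 - p)"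
          using l A B False pos 3 by (intro mult3_mono[OF order_refl powr_mono2' powr_mono2]) auto
        also have "\<dots> = 2 powr (- 1/2 - p) * l powr (1/2 + p)" using l by (simp add: mult_ac add.commute flip: powr_add)
        also have "\<dots> \<le> 2 powr (\<bar>p\<bar> + 1) * l powr (- \<mu>)"
          using \<mu> by (intro mult_mono two l\<mu>) auto
        finally show ?thesis .
      qed
    qed
    then have "l powr (1/2) * A powr p * B powr (- 1/2 - p) * B \<le> 2 powr (\<bar>p\<bar> + 1) * l powr (- \<mu>) * B"
      using pos by (intro mult_right_mono) auto
    moreover have "B powr (1/2 - p) = B powr (- 1/2 - p) * B"
    proof -
      have "B powr (- 1/2 - p) * B powr 1 = B powr (1/2 - p)" unfolding powr_add[symmetric] by simp
      then show ?thesis using pos by simp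
    qed
    ultimately show ?thesis using False l by (simp add: powr_half_sqrt mult_ac)
  qed
qed

text \<open>Here \<open>B\<close> is the cut-off distance of \<open>x\<close> from -1 and
  \<open>A\<close> that of the node from 1, the two points being far apart. The powers of
  \<open>B\<close> and \<open>A\<close> are extremal independently, at order 1 or at
  \<open>l\<close>; the four combinations give the powers \<open>1/2\<close>,
  \<open>1/2 + q\<close>, \<open>1 - p\<close> and \<open>1 + q - p\<close> of
  \<open>l\<close>.\<close>

lemma opposite_side_bound:
  fixes l A B p q \<mu> :: real
  assumes l: "0 < l" "l \<le> 1" and A: "l \<le> A" "A \<le> 1" and B: "l \<le> B" "B \<le> 2"
    and \<mu>: "0 \<le> \<mu>" "p - 1 \<le> \<mu>" "- 1/2 - q \<le> \<mu>" "p - q - 1 \<le> \<mu>"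
  shows "sqrt l * B powr q * A powr (1/2 - p) \<le> 2 powr \<bar>q\<bar> * l powr (- \<mu>)"
proof -
  have 1: "B powr q \<le> 2 powr \<bar>q\<bar> * l powr (min q 0)"
  proof (cases "q \<ge> 0")
    case True
    then show ?thesis using B l by (simp add: powr_mono2)
  next
    case False
    have "1 * B powr q \<le> 2 powr \<bar>q\<bar> * l powr q"
      using False B l by (intro mult_mono[OF ge_one_powr_ge_zero powr_mono2']) auto
    then show ?thesis using False by (simp add: min_def)
  qed
  have 2: "A powr (1/2 - p) \<le> l powr (min (1/2 - p) 0)"
  proof (cases "1/2 - p \<ge> 0")
    case True
    then show ?thesis using A l by (simp add: powr_le1)
  next
    case False
    then show ?thesis using A l by (simp add: min_def powr_mono2')
  qed
  have "sqrt l * B powr q * A powr (1/2 - p)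
      \<le> l powr (1/2) * (2 powr \<bar>q\<bar> * l powr (min q 0)) * l powr (min (1/2 - p) 0)"
    using 1 2 l by (intro mult_mono) (auto simp: powr_half_sqrt)
  also have "\<dots> = 2 powr \<bar>q\<bar> * l powr (1/2 + min q 0 + min (1/2 - p) 0)"
    by (simp add: powr_add mult_ac)
  also have "\<dots> \<le> 2 powr \<bar>q\<bar> * l powr (- \<mu>)"
    using \<mu> by (intro mult_left_mono powr_exponent_antimono[OF l]) (auto simp: min_def)
  finally show ?thesis .
qed

text \<open>Close to the node this is \<open>nodal_near\<close>. Farther away, dividing the upper
  bound at \<open>x\<close> by the lower bound at \<open>z\<close> eliminates the amplitude. The
  conditions on \<open>2 * \<mu>\<close> after the first are twice \<open>p - 1\<close>,
  \<open>- 1/2 - p\<close>, \<open>- 1/2 - q\<close> and \<open>p - q - 1\<close>.\<close>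

lemma nodal_quotient_bound_right:
  fixes \<alpha> \<beta> \<mu> :: real
  assumes ab: "\<alpha> > -1" "\<beta> > -1"
    and \<mu>: "0 \<le> \<mu>" "- \<alpha> - 1/2 \<le> 2 * \<mu>" "\<alpha> - 5/2 \<le> 2 * \<mu>" "\<beta> - 5/2 \<le> 2 * \<mu>" "\<beta> - \<alpha> - 2 \<le> 2 * \<mu>"
  shows "\<exists>C>0. \<forall>N y z x. jacobi_ode \<alpha> \<beta> N y \<longrightarrow> y \<noteq> 0 \<longrightarrow> 0 \<le> z \<longrightarrow> z \<le> 1 \<longrightarrow> poly (jacobi_ode.nodal y) z = 0 \<longrightarrow>
    \<bar>x\<bar> \<le> 1 \<longrightarrow> \<bar>poly (jacobi_ode.nodal y) x\<bar>
      \<le> C * (jacobi_ode.layer \<alpha> \<beta> N powr (- \<mu>) * (\<bar>x - z\<bar> * \<bar>poly (pderiv (jacobi_ode.nodal y)) z\<bar>))"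
proof -
  obtain C1 where C1: "C1 > 0" "\<And>N y x. jacobi_ode \<alpha> \<beta> N y \<Longrightarrow> \<bar>x\<bar> \<le> 1 \<Longrightarrow>
    \<bar>poly (jacobi_ode.nodal y) x\<bar> \<le> C1 * (jacobi_ode.amplitude \<alpha> \<beta> N y
      * sqrt (jacobi_ode.layer \<alpha> \<beta> N)
      * jacobi_ode.dist_right \<alpha> \<beta> N x powr (3/4 - \<alpha> / 2) * jacobi_ode.dist_left \<alpha> \<beta> N x powr (3/4 - \<beta> / 2))"
    using nodal_upper[OF ab] by blast
  obtain C2 where C2: "C2 > 0" "\<And>N y z. jacobi_ode \<alpha> \<beta> N y \<Longrightarrow> y \<noteq> 0 \<Longrightarrow> 0 \<le> z \<Longrightarrow> z \<le> 1 \<Longrightarrow> poly (jacobi_ode.nodal y) z = 0 \<Longrightarrow>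
    jacobi_ode.amplitude \<alpha> \<beta> N y * jacobi_ode.dist_right \<alpha> \<beta> N z powr (1/4 - \<alpha> / 2)
      \<le> C2 * \<bar>poly (pderiv (jacobi_ode.nodal y)) z\<bar>"
    using nodal_deriv_lower[OF ab] by blast
  obtain C3 where C3: "C3 > 0" "\<And>N y z x. jacobi_ode \<alpha> \<beta> N y \<Longrightarrow> y \<noteq> 0 \<Longrightarrow> 0 \<le> z \<Longrightarrow> z \<le> 1 \<Longrightarrow> poly (jacobi_ode.nodal y) z = 0 \<Longrightarrow>
    \<bar>x\<bar> \<le> 1 \<Longrightarrow> \<bar>x - z\<bar> < jacobi_ode.dist_right \<alpha> \<beta> N z / 2 \<Longrightarrow>
    \<bar>poly (jacobi_ode.nodal y) x\<bar> \<le> C3 * (\<bar>x - z\<bar> * \<bar>poly (pderiv (jacobi_ode.nodal y)) z\<bar>)"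
    using nodal_near[OF ab] by blast
  define p q where "p = 3/4 - \<alpha> / 2" and "q = 3/4 - \<beta> / 2"
  define K where "K = 2 powr (\<bar>p\<bar> + 1) * 2 powr \<bar>q\<bar>"
  define C where "C = max C3 (C1 * C2 * (3 * K))"
  have K0: "K \<ge> 0" by (simp add: K_def)
  have "\<bar>poly (jacobi_ode.nodal y) x\<bar>
      \<le> C * (jacobi_ode.layer \<alpha> \<beta> N powr (- \<mu>) * (\<bar>x - z\<bar> * \<bar>poly (pderiv (jacobi_ode.nodal y)) z\<bar>))"
    if J: "jacobi_ode \<alpha> \<beta> N y" and "y \<noteq> 0" and z: "0 \<le> z" "z \<le> 1" and node: "poly (jacobi_ode.nodal y) z = 0"
      and x: "\<bar>x\<bar> \<le> 1" for N y z x
  proof -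
    interpret jacobi_ode \<alpha> \<beta> N y by fact
    note l = layer_pos layer_le_1
    define w where "w = \<bar>poly (pderiv nodal) z\<bar>"
    define A B Z d where "A = dist_right x" and "B = dist_left x" and "Z = dist_right z" and "d = \<bar>x - z\<bar>"
    have w: "w \<ge> 0" by (simp add: w_def)
    have d: "d \<ge> 0" by (simp add: d_def)
    have AB: "layer \<le> A" "A \<le> 2" "layer \<le> B" "B \<le> 2" "layer \<le> Z" "Z \<le> 1" "1 - x \<le> A"
      using x z l by (auto simp: A_def B_def Z_def dist_right_def dist_left_def)
    have pos: "A > 0" "B > 0" "Z > 0" using AB l by auto
    have "1 \<le> layer powr (- \<mu>)"
      using powr_exponent_antimono[of layer "-\<mu>" 0] l \<mu> by simp
    show ?thesis
    proof (cases "d < Z / 2")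
      case True
      then have "\<bar>poly nodal x\<bar> \<le> C3 * (1 * (d * w))"
        using C3(2)[OF J \<open>y \<noteq> 0\<close> z node x] by (simp add: d_def Z_def w_def)
      also have "\<dots> \<le> C * (layer powr (- \<mu>) * (d * w))"
        using \<open>1 \<le> layer powr (- \<mu>)\<close> w d C3(1) by (intro mult_mono) (auto simp: C_def)
      finally show ?thesis by (simp add: d_def w_def)
    next
      case False
      \<comment> \<open>The cut-off distance is 1-Lipschitz; together with
        \<open>Z \<le> 2 * d\<close> this yields the factor 3.\<close>
      have "A \<le> Z + d" using AB by (auto simp: A_def Z_def d_def dist_right_def)
      then have mx: "max A Z \<le> 3 * d" using False d by auto
      have key: "sqrt layer * A powr p * B powr q * Z powr (1/2 - p) \<le> 3 * K * layer powr (- \<mu>) * d"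
      \<comment> \<open>For \<open>x \<ge> - 1/2\<close> the power of \<open>B\<close> is bounded;
        otherwise that of \<open>A\<close> is, and \<open>d \<ge> 1/2\<close> because
        \<open>z \<ge> 0\<close>.\<close>
      proof (cases "x \<ge> - 1/2")
        case True
        then have "1/2 \<le> B" by (simp add: B_def dist_left_def le_max_iff_disj)
        then have b1: "B powr q \<le> 2 powr \<bar>q\<bar>"
          using AB by (intro powr_le_two_powr) auto
        have b2: "sqrt layer * A powr p * Z powr (1/2 - p) \<le> 2 powr (\<bar>p\<bar> + 1) * layer powr (- \<mu>) * max A Z"
          using AB \<mu> by (intro same_side_bound l) (auto simp: p_def)
        have "(sqrt layer * A powr p * Z powr (1/2 - p)) * B powr q
            \<le> (2 powr (\<bar>p\<bar> + 1) * layer powr (- \<mu>) * max A Z) * 2 powr \<bar>q\<bar>"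
          by (rule mult_mono[OF b2 b1]) (use pos in auto)
        also have "\<dots> = K * layer powr (- \<mu>) * max A Z" by (simp add: K_def mult_ac)
        also have "\<dots> \<le> K * layer powr (- \<mu>) * (3 * d)"
          using mx K0 by (intro mult_left_mono) auto
        finally show ?thesis by (simp add: mult_ac)
      next
        case False
        then have x': "1 \<le> A" "1/2 \<le> d" using AB z by (auto simp: d_def)
        have b1: "A powr p \<le> 2 powr \<bar>p\<bar>" using x' AB by (intro powr_le_two_powr) auto
        have b2: "sqrt layer * B powr q * Z powr (1/2 - p) \<le> 2 powr \<bar>q\<bar> * layer powr (- \<mu>)"
          using AB \<mu> by (intro opposite_side_bound l) (auto simp: p_def q_def field_simps)
        have "(sqrt layer * B powr q * Z powr (1/2 - p)) * A powr p
            \<le> (2 powr \<bar>q\<bar> * layer powr (- \<mu>)) * 2 powr \<bar>p\<bar>"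
          by (rule mult_mono[OF b2 b1]) auto
        also have "\<dots> = K * layer powr (- \<mu>) * (1/2)" by (simp add: K_def powr_add mult_ac)
        also have "\<dots> \<le> K * layer powr (- \<mu>) * (3 * d)"
          using x' K0 by (intro mult_left_mono) auto
        finally show ?thesis by (simp add: mult_ac)
      qed
      have amp: "amplitude \<le> C2 * w * Z powr (1/2 - p)"
      proof -
        have "amplitude * Z powr (1/4 - \<alpha> / 2) \<le> C2 * w"
          using C2(2)[OF J \<open>y \<noteq> 0\<close> z node] by (simp add: Z_def w_def)
        then have "amplitude \<le> C2 * w * Z powr (- (1/4 - \<alpha> / 2))" using powr_shift'[OF pos(3)] by blast
        also have "- (1/4 - \<alpha> / 2) = 1/2 - p" by (simp add: p_def)
        finally show ?thesis .
      qed
      have "\<bar>poly nodal x\<bar> \<le> C1 * (amplitude * (sqrt layer * A powr p * B powr q))"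
        using C1(2)[OF J x] by (simp add: A_def B_def p_def q_def mult.assoc)
      also have "\<dots> \<le> C1 * ((C2 * w * Z powr (1/2 - p)) * (sqrt layer * A powr p * B powr q))"
        using amp C1(1) l by (intro mult_left_mono mult_right_mono) auto
      also have "\<dots> = C1 * C2 * w * (sqrt layer * A powr p * B powr q * Z powr (1/2 - p))"
        by (simp add: mult_ac)
      also have "\<dots> \<le> C1 * C2 * w * (3 * K * layer powr (- \<mu>) * d)"
        using key C1(1) C2(1) w by (intro mult_left_mono) auto
      also have "\<dots> = C1 * C2 * (3 * K) * (layer powr (- \<mu>) * (d * w))" by (simp add: mult_ac)
      also have "\<dots> \<le> C * (layer powr (- \<mu>) * (d * w))"
        using d w by (intro mult_right_mono) (auto simp: C_def)
      finally show ?thesis by (simp add: d_def w_def)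
    qed
  qed
  moreover have "C > 0" using C3(1) by (simp add: C_def less_max_iff_disj)
  ultimately show ?thesis by blast
qed

text \<open>Nodes with \<open>z < 0\<close> are handled by reflection, so the conditions are those
  of the right half together with their images under exchanging \<alpha> and \<beta>.\<close>

lemma nodal_quotient_bound:
  fixes \<alpha> \<beta> \<mu> :: real
  assumes ab: "\<alpha> > -1" "\<beta> > -1"
    and \<mu>: "0 \<le> \<mu>" "- \<alpha> - 1/2 \<le> 2 * \<mu>" "\<alpha> - 5/2 \<le> 2 * \<mu>" "\<beta> - \<alpha> - 2 \<le> 2 * \<mu>"
      "- \<beta> - 1/2 \<le> 2 * \<mu>" "\<beta> - 5/2 \<le> 2 * \<mu>" "\<alpha> - \<beta> - 2 \<le> 2 * \<mu>"
  shows "\<exists>C>0. \<forall>N y z x. jacobi_ode \<alpha> \<beta> N y \<longrightarrow> y \<noteq> 0 \<longrightarrow> \<bar>z\<bar> \<le> 1 \<longrightarrow> poly (jacobi_ode.nodal y) z = 0 \<longrightarrow>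
    \<bar>x\<bar> \<le> 1 \<longrightarrow> \<bar>poly (jacobi_ode.nodal y) x\<bar>
      \<le> C * (jacobi_ode.layer \<alpha> \<beta> N powr (- \<mu>) * (\<bar>x - z\<bar> * \<bar>poly (pderiv (jacobi_ode.nodal y)) z\<bar>))"
proof -
  obtain C1 where C1: "C1 > 0" "\<And>N y z x. jacobi_ode \<alpha> \<beta> N y \<Longrightarrow> y \<noteq> 0 \<Longrightarrow> 0 \<le> z \<Longrightarrow> z \<le> 1 \<Longrightarrow> poly (jacobi_ode.nodal y) z = 0 \<Longrightarrow>
    \<bar>x\<bar> \<le> 1 \<Longrightarrow> \<bar>poly (jacobi_ode.nodal y) x\<bar>
      \<le> C1 * (jacobi_ode.layer \<alpha> \<beta> N powr (- \<mu>) * (\<bar>x - z\<bar> * \<bar>poly (pderiv (jacobi_ode.nodal y)) z\<bar>))"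
    using nodal_quotient_bound_right[OF ab, of \<mu>] \<mu> by blast
  obtain C2 where C2: "C2 > 0" "\<And>N y z x. jacobi_ode \<beta> \<alpha> N y \<Longrightarrow> y \<noteq> 0 \<Longrightarrow> 0 \<le> z \<Longrightarrow> z \<le> 1 \<Longrightarrow> poly (jacobi_ode.nodal y) z = 0 \<Longrightarrow>
    \<bar>x\<bar> \<le> 1 \<Longrightarrow> \<bar>poly (jacobi_ode.nodal y) x\<bar>
      \<le> C2 * (jacobi_ode.layer \<beta> \<alpha> N powr (- \<mu>) * (\<bar>x - z\<bar> * \<bar>poly (pderiv (jacobi_ode.nodal y)) z\<bar>))"
    using nodal_quotient_bound_right[OF ab(2,1), of \<mu>] \<mu> by blast
  have "\<bar>poly (jacobi_ode.nodal y) x\<bar>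
      \<le> max C1 C2 * (jacobi_ode.layer \<alpha> \<beta> N powr (- \<mu>) * (\<bar>x - z\<bar> * \<bar>poly (pderiv (jacobi_ode.nodal y)) z\<bar>))"
    if J: "jacobi_ode \<alpha> \<beta> N y" and "y \<noteq> 0" and z: "\<bar>z\<bar> \<le> 1" and node: "poly (jacobi_ode.nodal y) z = 0"
      and x: "\<bar>x\<bar> \<le> 1" for N y z x
  proof -
    interpret jacobi_ode \<alpha> \<beta> N y by fact
    define P where "P = layer powr (- \<mu>) * (\<bar>x - z\<bar> * \<bar>poly (pderiv nodal) z\<bar>)"
    have P: "P \<ge> 0" by (simp add: P_def)
    have "\<bar>poly nodal x\<bar> \<le> C1 * P \<or> \<bar>poly nodal x\<bar> \<le> C2 * P"
    proof (cases "z \<ge> 0")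
      case True
      then show ?thesis using C1(2)[OF J \<open>y \<noteq> 0\<close>, of z x] z node x by (simp add: P_def)
    next
      case False
      have "pcompose y [:0, -1:] \<noteq> 0" using \<open>y \<noteq> 0\<close> by (simp add: pcompose_eq_0_iff)
      then show ?thesis using C2(2)[OF reflected, of "-z" "-x"] False z node x
        by (simp add: P_def nodal_reflected layer_reflected[OF J] abs_minus_commute)
    qed
    moreover have "C1 * P \<le> max C1 C2 * P" by (rule mult_right_mono[OF _ P]) simp
    moreover have "C2 * P \<le> max C1 C2 * P" by (rule mult_right_mono[OF _ P]) simp
    ultimately show ?thesis unfolding P_def[symmetric] by linarith
  qed
  moreover have "max C1 C2 > 0" using C1(1) by simp
  ultimately show ?thesis by blast
qed

section \<open>Lagrange basis at the Lobatto nodes\<close>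

context jacobi_weight
begin

lemma jacobi_ode_eigenpoly:
  assumes "m \<ge> 1"
  shows "jacobi_ode \<alpha> \<beta> (real m + (\<alpha> + \<beta> + 1) / 2) (eigenpoly m)"
proof
  have m: "real m \<ge> 1" using assms by simp
  show "1 / 2 \<le> real m + (\<alpha> + \<beta> + 1) / 2" using m alpha beta by (simp add: field_simps)
  have e: "(real m + (\<alpha> + \<beta> + 1) / 2)\<^sup>2 - ((\<alpha> + \<beta> + 1) / 2)\<^sup>2 = eigenvalue m"
    by (simp add: eigenvalue_def power2_eq_square field_simps)
  have "eigenvalue m \<ge> 0"
    unfolding eigenvalue_def using m alpha beta by (intro mult_nonneg_nonneg) auto
  then show "((\<alpha> + \<beta> + 1) / 2)\<^sup>2 \<le> (real m + (\<alpha> + \<beta> + 1) / 2)\<^sup>2" using e by linarith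
  show "(1 - x\<^sup>2) * poly (pderiv (pderiv (eigenpoly m))) x
      + (\<beta> - \<alpha> - (\<alpha> + \<beta> + 2) * x) * poly (pderiv (eigenpoly m)) x
      + ((real m + (\<alpha> + \<beta> + 1) / 2)\<^sup>2 - ((\<alpha> + \<beta> + 1) / 2)\<^sup>2) * poly (eigenpoly m) x = 0" for x
    using is_eigenpoly_eigenpoly[of m] unfolding e is_eigenpoly_def by blast
qed (fact alpha beta)+

text \<open>Simplicity of the nodes is a by-product of the quotient bound: with a vanishing
  derivative the nodal polynomial would vanish on all of \<open>{-1..1}\<close>. Any admissible
  \<open>\<mu>\<close> will do, and \<open>\<bar>\<alpha>\<bar> + \<bar>\<beta>\<bar> + 3\<close>
  satisfies every condition.\<close>

lemma nodal_deriv_nonzero: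
  assumes "jacobi_ode \<alpha> \<beta> N y" "y \<noteq> 0" "\<bar>z\<bar> \<le> 1" "poly (jacobi_ode.nodal y) z = 0"
  shows "poly (pderiv (jacobi_ode.nodal y)) z \<noteq> 0"
proof
  interpret jacobi_ode \<alpha> \<beta> N y by fact
  assume zero: "poly (pderiv nodal) z = 0"
  define a b where "a = \<bar>\<alpha>\<bar>" and "b = \<bar>\<beta>\<bar>"
  have ab: "\<alpha> \<le> a" "- \<alpha> \<le> a" "\<beta> \<le> b" "- \<beta> \<le> b" by (simp_all add: a_def b_def)
  define \<mu> where "\<mu> = a + b + 3"
  have \<mu>: "0 \<le> \<mu>" "- \<alpha> - 1/2 \<le> 2 * \<mu>" "\<alpha> - 5/2 \<le> 2 * \<mu>" "\<beta> - \<alpha> - 2 \<le> 2 * \<mu>"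
      "- \<beta> - 1/2 \<le> 2 * \<mu>" "\<beta> - 5/2 \<le> 2 * \<mu>" "\<alpha> - \<beta> - 2 \<le> 2 * \<mu>"
    using ab by (simp_all add: \<mu>_def)
  obtain C where C: "\<And>x. \<bar>x\<bar> \<le> 1 \<Longrightarrow> \<bar>poly nodal x\<bar>
      \<le> C * (layer powr (- \<mu>) * (\<bar>x - z\<bar> * \<bar>poly (pderiv nodal) z\<bar>))"
    using nodal_quotient_bound[OF alpha beta \<mu>] assms by blast
  have "poly nodal x = 0" if "x \<in> {-1..1}" for x
  proof -
    have "\<bar>x\<bar> \<le> 1" using that by (simp add: abs_le_iff)
    from C[OF this] show ?thesis using zero by simp
  qed
  then have "{-1..1} \<subseteq> {x. poly nodal x = 0}" by auto
  moreover have "nodal \<noteq> 0" unfolding nodal_def mult_eq_0_iff using assms(2) by simp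
  moreover have "infinite {-1..1::real}" by simp
  ultimately show False using poly_roots_finite finite_subset by blast
qed

abbreviation lobatto_set :: "nat \<Rightarrow> real set" where
  "lobatto_set m \<equiv> {x. (1 - x\<^sup>2) * poly (eigenpoly m) x = 0}"

lemma lobatto_set:
  assumes "m \<ge> 1"
  shows "finite (lobatto_set m)" and "card (lobatto_set m) = m + 2" and "lobatto_set m \<subseteq> {-1..1}"
    and "\<exists>c. c \<noteq> 0 \<and> [:1, 0, -1:] * eigenpoly m = smult c (\<Prod>r\<in>lobatto_set m. [:- r, 1:])"
proof -
  note J = jacobi_ode_eigenpoly[OF assms]
  interpret jacobi_ode \<alpha> \<beta> "real m + (\<alpha> + \<beta> + 1) / 2" "eigenpoly m" by (rule J)
  define R where "R = {x. -1 < x \<and> x < 1 \<and> poly (eigenpoly m) x = 0}"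
  \<comment> \<open>At an interior root the derivative of the nodal polynomial is
    \<open>1 - x\<^sup>2\<close> times that of the eigenpolynomial, so simple nodes mean simple
    roots.\<close>
  have simple: "poly (pderiv (eigenpoly m)) x \<noteq> 0"
    if "-1 < x" "x < 1" "poly (eigenpoly m) x = 0" for x
    using nodal_deriv_nonzero[OF J, of x] that by (auto simp: poly_nodal poly_pderiv_nodal)
  have R: "finite R" "card R = m" using card_roots_eigenpoly[OF simple, folded R_def] by blast+
  obtain c where c: "eigenpoly m = smult c (\<Prod>r\<in>R. [:- r, 1:])"
    using card_roots_eigenpoly(1)[OF simple, folded R_def] by blast
  have c0: "c \<noteq> 0" using c eigenpoly_nonzero[of m] by auto
  have "poly (eigenpoly m) x = 0 \<longleftrightarrow> x \<in> R" for x
    using R(1) c0 by (subst c) (auto simp: poly_prod)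
  then have set: "lobatto_set m = insert 1 (insert (-1) R)"
    by (auto simp: power2_eq_1_iff)
  have notin: "-1 \<notin> R" "1 \<notin> insert (-1) R" by (auto simp: R_def)
  show "finite (lobatto_set m)" "card (lobatto_set m) = m + 2"
    unfolding set using R notin by auto
  show "lobatto_set m \<subseteq> {-1..1}" unfolding set by (auto simp: R_def)
  have "[:1, 0, -1 :: real:] = smult (- 1) ([:- 1, 1:] * [:- (-1), 1:])" by simp
  then have "[:1, 0, -1:] * eigenpoly m = smult (- 1) ([:- 1, 1:] * [:- (-1), 1:]) * smult c (\<Prod>r\<in>R. [:- r, 1:])"
    using c by (simp only:)
  also have "\<dots> = smult (- c) ([:- 1, 1:] * ([:- (-1), 1:] * (\<Prod>r\<in>R. [:- r, 1:])))"
    unfolding mult_smult_left mult_smult_right smult_smult by (simp only: mult.assoc mult_minus1_right mult_minus1)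
  also have "\<dots> = smult (- c) (\<Prod>r\<in>lobatto_set m. [:- r, 1:])"
    unfolding set using R(1) notin by (simp only: prod.insert finite_insert simp_thms)
  finally show "\<exists>c. c \<noteq> 0 \<and> [:1, 0, -1:] * eigenpoly m = smult c (\<Prod>r\<in>lobatto_set m. [:- r, 1:])"
    using c0 by (intro exI[of _ "-c"]) auto
qed

text \<open>Nodes are counted from 1 and list positions from 0; the degree \<open>m\<close> belongs
  to \<open>n = m + 2\<close> nodes.\<close>

lemma lobatto_node_bij:
  assumes "m \<ge> 1"
  shows "bij_betw (lobatto_node \<alpha> \<beta> (m + 2)) {1..m + 2} (lobatto_set m)"
proof -
  note S = lobatto_set[OF assms]
  have "bij_betw (\<lambda>i. sorted_list_of_set (lobatto_set m) ! i) {..<m + 2} (lobatto_set m)"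
    using S(1,2) by (intro bij_betw_nth) auto
  moreover have "bij_betw (\<lambda>j. j - 1) {1..m + 2} {..<m + 2}"
    by (rule bij_betwI[where g = Suc]) auto
  ultimately have "bij_betw ((\<lambda>i. sorted_list_of_set (lobatto_set m) ! i) \<circ> (\<lambda>j. j - 1)) {1..m + 2} (lobatto_set m)"
    by (rule bij_betw_trans[rotated])
  then show ?thesis by (simp add: lobatto_node_def[abs_def] jacobi_poly_eq o_def)
qed

text \<open>The assumed inequality is invariant under scaling, so it passes to the monic
  \<open>\<omega>\<close>. Off the node it bounds
  \<open>\<omega> x / ((x - z) * \<omega>' z)\<close> by \<open>B\<close>; at the node the value is
  1, which \<open>B \<ge> 1\<close> covers.\<close>

lemma lagrange_basis_bound:
  assumes "m \<ge> 1" and j: "j \<in> {1..m + 2}" and x: "\<bar>x\<bar> \<le> 1"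
    and bound: "\<And>z x. \<bar>z\<bar> \<le> 1 \<Longrightarrow> poly ([:1, 0, -1:] * eigenpoly m) z = 0 \<Longrightarrow> \<bar>x\<bar> \<le> 1 \<Longrightarrow>
      \<bar>poly ([:1, 0, -1:] * eigenpoly m) x\<bar> \<le> B * (\<bar>x - z\<bar> * \<bar>poly (pderiv ([:1, 0, -1:] * eigenpoly m)) z\<bar>)"
    and "B \<ge> 1"
  shows "\<bar>poly (lagrange_basis (lobatto_node \<alpha> \<beta> (m + 2)) (m + 2) j) x\<bar> \<le> B"
proof -
  note S = lobatto_set[OF \<open>m \<ge> 1\<close>]
  define t where "t = lobatto_node \<alpha> \<beta> (m + 2)"
  note bij = lobatto_node_bij[OF \<open>m \<ge> 1\<close>, folded t_def]
  define z where "z = t j"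
  have zS: "z \<in> lobatto_set m" using bij j by (auto simp: z_def bij_betw_def)
  define \<omega> where "\<omega> = node_poly t (m + 2)"
  have \<omega>: "\<omega> = (\<Prod>r\<in>lobatto_set m. [:- r, 1:])"
    unfolding \<omega>_def node_poly_def by (rule prod.reindex_bij_betw[OF bij])
  obtain c where c: "c \<noteq> 0" "[:1, 0, -1:] * eigenpoly m = smult c \<omega>" using S(4) \<omega> by auto
  have "poly \<omega> z = 0" unfolding \<omega> using S(1) zS by (auto simp: poly_prod)
  then obtain q where q: "\<omega> = [:- z, 1:] * q" unfolding poly_eq_0_iff_dvd by (elim dvdE)
  have q_div: "\<omega> div [:- z, 1:] = q" unfolding q by (rule nonzero_mult_div_cancel_left) simp
  have q_z: "poly q z = poly (pderiv \<omega>) z" unfolding q pderiv_mult by (simp add: pderiv_pCons)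
  have z1: "\<bar>z\<bar> \<le> 1" using S(3) zS by (auto simp: abs_le_iff)
  have B: "\<bar>poly \<omega> u\<bar> \<le> B * (\<bar>u - z\<bar> * \<bar>poly (pderiv \<omega>) z\<bar>)" if "\<bar>u\<bar> \<le> 1" for u
  proof -
    have "\<bar>c\<bar> * \<bar>poly \<omega> u\<bar> \<le> \<bar>c\<bar> * (B * (\<bar>u - z\<bar> * \<bar>poly (pderiv \<omega>) z\<bar>))"
      using bound[OF z1 _ that] \<open>poly \<omega> z = 0\<close> unfolding c(2) by (simp add: pderiv_smult abs_mult mult_ac)
    then show ?thesis using c(1) by simp
  qed
  have nz: "poly (pderiv \<omega>) z \<noteq> 0"
  proof
    assume "poly (pderiv \<omega>) z = 0"
    then have "poly \<omega> u = 0" if "\<bar>u\<bar> \<le> 1" for u using B[OF that] by simp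
    then have "{-1..1} \<subseteq> {x. poly \<omega> x = 0}" by (auto simp: abs_le_iff)
    moreover have "\<omega> \<noteq> 0" unfolding \<omega> using S(1) by simp
    moreover have "infinite {-1..1::real}" by simp
    ultimately show False using poly_roots_finite finite_subset by blast
  qed
  have val: "poly (lagrange_basis t (m + 2) j) x = poly q x / poly (pderiv \<omega>) z"
    unfolding lagrange_basis_def \<omega>_def[symmetric] z_def[symmetric] q_div by simp
  show ?thesis
  proof (cases "x = z")
    case True
    then show ?thesis using val q_z nz \<open>B \<ge> 1\<close> by (simp add: t_def)
  next
    case False
    have "\<bar>x - z\<bar> * \<bar>poly q x\<bar> \<le> \<bar>x - z\<bar> * (B * \<bar>poly (pderiv \<omega>) z\<bar>)"
      using B[OF x] unfolding q by (simp add: abs_mult[symmetric] algebra_simps)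
    then have "\<bar>poly q x\<bar> \<le> B * \<bar>poly (pderiv \<omega>) z\<bar>" using False by simp
    then show ?thesis using nz unfolding t_def[symmetric] val by (simp add: abs_divide pos_divide_le_eq)
  qed
qed

lemma max_lobatto_norm_bound:
  assumes "m \<ge> 1"
    and bound: "\<And>z x. \<bar>z\<bar> \<le> 1 \<Longrightarrow> poly ([:1, 0, -1:] * eigenpoly m) z = 0 \<Longrightarrow> \<bar>x\<bar> \<le> 1 \<Longrightarrow>
      \<bar>poly ([:1, 0, -1:] * eigenpoly m) x\<bar> \<le> B * (\<bar>x - z\<bar> * \<bar>poly (pderiv ([:1, 0, -1:] * eigenpoly m)) z\<bar>)"
    and "B \<ge> 1"
  shows "\<bar>max_lobatto_norm \<alpha> \<beta> (m + 2)\<bar> \<le> B"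
proof -
  define f where "f j = sup_norm (lagrange_basis (lobatto_node \<alpha> \<beta> (m + 2)) (m + 2) j)" for j
  have le: "\<bar>poly (lagrange_basis (lobatto_node \<alpha> \<beta> (m + 2)) (m + 2) j) x\<bar> \<le> B"
    if "j \<in> {1..m + 2}" "x \<in> {-1..1}" for j x
    using that lagrange_basis_bound[OF assms(1) that(1) _ bound \<open>B \<ge> 1\<close>, of x] by (auto simp: abs_le_iff)
  have upper: "f j \<le> B" if "j \<in> {1..m + 2}" for j
    unfolding f_def sup_norm_def by (rule cSUP_least) (use le[OF that] in auto)
  \<comment> \<open>The Landau symbol concerns the absolute value, so the maximum must also be
    nonnegative; evaluation at 0 shows this, the supremum being finite by \<open>le\<close>.\<close>
  have lower: "0 \<le> f j" if "j \<in> {1..m + 2}" for j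
  proof -
    have "\<bar>poly (lagrange_basis (lobatto_node \<alpha> \<beta> (m + 2)) (m + 2) j) 0\<bar> \<le> f j"
      unfolding f_def sup_norm_def
      by (rule cSUP_upper) (use le[OF that] in \<open>auto intro!: bdd_aboveI2[of _ _ B]\<close>)
    then show ?thesis by linarith
  qed
  have "Max (f ` {1..m + 2}) \<le> B" using upper by (intro Max.boundedI) auto
  moreover have "0 \<le> Max (f ` {1..m + 2})"
    using lower[of 1] by (intro order_trans[OF _ Max_ge[of _ "f 1"]]) auto
  ultimately show ?thesis by (simp add: max_lobatto_norm_def f_def)
qed

end

text \<open>\<open>layer\<close> to the power \<open>- (\<kappa> / 2)\<close> is
  \<open>N / sqrt near_radius\<close> to the power \<kappa>, and \<open>N\<close> is at most a
  constant times \<open>n\<close>. The conditions are those of \<open>nodal_quotient_bound\<close>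
  for \<open>2 * \<mu> = \<kappa>\<close>.\<close>

lemma max_lobatto_norm_bigo:
  fixes \<alpha> \<beta> \<kappa> :: real
  assumes ab: "\<alpha> > -1" "\<beta> > -1"
    and \<kappa>: "0 \<le> \<kappa>" "- \<alpha> - 1/2 \<le> \<kappa>" "\<alpha> - 5/2 \<le> \<kappa>" "\<beta> - \<alpha> - 2 \<le> \<kappa>"
      "- \<beta> - 1/2 \<le> \<kappa>" "\<beta> - 5/2 \<le> \<kappa>" "\<alpha> - \<beta> - 2 \<le> \<kappa>"
  shows "max_lobatto_norm \<alpha> \<beta> \<in> O(\<lambda>n. real n powr \<kappa>)"
proof -
  interpret jacobi_weight \<alpha> \<beta> using ab by unfold_locales
  obtain C where C: "C > 0" "\<And>N y z x. jacobi_ode \<alpha> \<beta> N y \<Longrightarrow> y \<noteq> 0 \<Longrightarrow> \<bar>z\<bar> \<le> 1 \<Longrightarrow>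
    poly (jacobi_ode.nodal y) z = 0 \<Longrightarrow> \<bar>x\<bar> \<le> 1 \<Longrightarrow> \<bar>poly (jacobi_ode.nodal y) x\<bar>
      \<le> C * (jacobi_ode.layer \<alpha> \<beta> N powr (- (\<kappa> / 2)) * (\<bar>x - z\<bar> * \<bar>poly (pderiv (jacobi_ode.nodal y)) z\<bar>))"
    using nodal_quotient_bound[OF ab, of "\<kappa> / 2"] \<kappa> by auto
  define r where "r = jacobi_ode.near_radius \<alpha> \<beta>"
  define D where "D = (1 + \<bar>(\<alpha> + \<beta> + 1) / 2\<bar>) / sqrt r"
  \<comment> \<open>For \<open>n \<ge> 3\<close> the degree \<open>n - 2\<close> is at least 1; for
    degree 0 the number \<open>N\<close> could even be negative.\<close>
  have "norm (max_lobatto_norm \<alpha> \<beta> n) \<le> (max 1 C * D powr \<kappa>) * norm (real n powr \<kappa>)" if "n \<ge> 3" for n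
  proof -
    define m where "m = n - 2"
    have m: "m \<ge> 1" "n = m + 2" using that by (auto simp: m_def)
    define N where "N = real m + (\<alpha> + \<beta> + 1) / 2"
    note J = jacobi_ode_eigenpoly[OF m(1), folded N_def]
    interpret jacobi_ode \<alpha> \<beta> N "eigenpoly m" by (rule J)
    have r: "r > 0" using near_radius_pos by (simp add: r_def)
    have L: "layer powr (- (\<kappa> / 2)) = (N / sqrt r) powr \<kappa>"
    proof -
      have "layer = (N / sqrt r) powr (- 2)"
        using N_pos r by (simp add: layer_def r_def powr_minus power_divide)
      then show ?thesis by (simp add: powr_powr)
    qed
    have "N \<le> (1 + \<bar>(\<alpha> + \<beta> + 1) / 2\<bar>) * real n"
    proof -
      have "N \<le> real n + \<bar>(\<alpha> + \<beta> + 1) / 2\<bar> * 1" by (simp add: N_def m(2))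
      also have "\<dots> \<le> real n + \<bar>(\<alpha> + \<beta> + 1) / 2\<bar> * real n"
        using that by (intro add_left_mono mult_left_mono) auto
      finally show ?thesis by (simp add: algebra_simps)
    qed
    then have "N / sqrt r \<le> D * real n" using r by (simp add: D_def divide_right_mono)
    then have "layer powr (- (\<kappa> / 2)) \<le> (D * real n) powr \<kappa>"
      unfolding L using N_pos r \<kappa>(1) by (intro powr_mono2) auto
    also have "\<dots> = D powr \<kappa> * real n powr \<kappa>"
      by (rule powr_mult)
    finally have Lb: "layer powr (- (\<kappa> / 2)) \<le> D powr \<kappa> * real n powr \<kappa>" .
    have L1: "1 \<le> layer powr (- (\<kappa> / 2))"
      using powr_exponent_antimono[of layer "- (\<kappa> / 2)" 0] layer_pos layer_le_1 \<kappa>(1) by simp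
    have "\<bar>max_lobatto_norm \<alpha> \<beta> (m + 2)\<bar> \<le> max 1 C * layer powr (- (\<kappa> / 2))"
    proof (rule max_lobatto_norm_bound[OF m(1)])
      fix z x :: real
      assume "\<bar>z\<bar> \<le> 1" "poly ([:1, 0, -1:] * eigenpoly m) z = 0" "\<bar>x\<bar> \<le> 1"
      then have "\<bar>poly nodal x\<bar> \<le> C * (layer powr (- (\<kappa> / 2)) * (\<bar>x - z\<bar> * \<bar>poly (pderiv nodal) z\<bar>))"
        by (intro C(2)[OF J]) (simp_all add: nodal_def)
      also have "\<dots> \<le> max 1 C * (layer powr (- (\<kappa> / 2)) * (\<bar>x - z\<bar> * \<bar>poly (pderiv nodal) z\<bar>))"
        by (intro mult_right_mono) auto
      finally show "\<bar>poly ([:1, 0, -1:] * eigenpoly m) x\<bar>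
          \<le> max 1 C * layer powr (- (\<kappa> / 2)) * (\<bar>x - z\<bar> * \<bar>poly (pderiv ([:1, 0, -1:] * eigenpoly m)) z\<bar>)"
        unfolding nodal_def by (simp only: mult.assoc)
    next
      show "1 \<le> max 1 C * layer powr (- (\<kappa> / 2))"
        using mult_mono[of 1 "max 1 C" 1 "layer powr (- (\<kappa> / 2))"] L1 by simp
    qed
    also have "\<dots> \<le> max 1 C * (D powr \<kappa> * real n powr \<kappa>)"
      using Lb by (intro mult_left_mono) auto
    finally show ?thesis by (simp add: m(2) mult.assoc)
  qed
  then show ?thesis
    by (intro bigoI[of _ "max 1 C * D powr \<kappa>"] eventually_sequentiallyI[of 3])
qed

text \<open>In each case \<kappa> is minus the minimum. The bounds absent from its list follow from
  the parameter range: \<open>\<alpha> \<le> 3/2\<close> gives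
  \<open>\<alpha> - 5/2 \<le> - 1\<close> and
  \<open>\<alpha> - \<beta> - 2 \<le> - \<beta> - 1/2\<close>, while \<open>\<alpha> > 3/2\<close>
  gives \<open>- \<alpha> - 1/2 < 0\<close>; likewise for \<beta>.\<close>

theorem mainTheorem7:
  fixes \<alpha> \<beta> :: real
  assumes "\<alpha> > -1" and "\<beta> > -1"
  shows "(\<alpha> \<le> 3/2 \<and> \<beta> \<le> 3/2 \<longrightarrow>
            max_lobatto_norm \<alpha> \<beta> \<in>
              O(\<lambda>n. real n powr (- Min {0, \<alpha> + 1/2, \<beta> + 1/2}))) \<and>
         (\<alpha> \<le> 3/2 \<and> \<beta> > 3/2 \<longrightarrow>
            max_lobatto_norm \<alpha> \<beta> \<in>
              O(\<lambda>n. real n powr (- Min {0, \<alpha> + 1/2, 2 + \<alpha> - \<beta>, 5/2 - \<beta>}))) \<and>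
         (\<alpha> > 3/2 \<and> \<beta> \<le> 3/2 \<longrightarrow>
            max_lobatto_norm \<alpha> \<beta> \<in>
              O(\<lambda>n. real n powr (- Min {0, \<beta> + 1/2, 2 + \<beta> - \<alpha>, 5/2 - \<alpha>}))) \<and>
         (\<alpha> > 3/2 \<and> \<beta> > 3/2 \<longrightarrow>
            max_lobatto_norm \<alpha> \<beta> \<in>
              O(\<lambda>n. real n powr (- Min {0, 2 + \<alpha> - \<beta>, 2 + \<beta> - \<alpha>, 5/2 - \<alpha>, 5/2 - \<beta>})))"
proof (intro conjI impI)
  have Min_le': "Min A \<le> a" if "finite A" "a \<in> A" for a and A :: "real set"
    using that by simp
  {
    assume "\<alpha> \<le> 3/2 \<and> \<beta> \<le> 3/2"
    moreover define \<mu> where "\<mu> = Min {0, \<alpha> + 1/2, \<beta> + 1/2}"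
    moreover have "\<mu> \<le> 0" "\<mu> \<le> \<alpha> + 1/2" "\<mu> \<le> \<beta> + 1/2"
      unfolding \<mu>_def by (intro Min_le'; simp)+
    ultimately show "max_lobatto_norm \<alpha> \<beta> \<in> O(\<lambda>n. real n powr (- Min {0, \<alpha> + 1/2, \<beta> + 1/2}))"
      unfolding \<mu>_def[symmetric] by (intro max_lobatto_norm_bigo assms; linarith)
  next
    assume "\<alpha> \<le> 3/2 \<and> \<beta> > 3/2"
    moreover define \<mu> where "\<mu> = Min {0, \<alpha> + 1/2, 2 + \<alpha> - \<beta>, 5/2 - \<beta>}"
    moreover have "\<mu> \<le> 0" "\<mu> \<le> \<alpha> + 1/2" "\<mu> \<le> 2 + \<alpha> - \<beta>" "\<mu> \<le> 5/2 - \<beta>"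
      unfolding \<mu>_def by (intro Min_le'; simp)+
    ultimately show "max_lobatto_norm \<alpha> \<beta> \<in> O(\<lambda>n. real n powr (- Min {0, \<alpha> + 1/2, 2 + \<alpha> - \<beta>, 5/2 - \<beta>}))"
      unfolding \<mu>_def[symmetric] by (intro max_lobatto_norm_bigo assms; linarith)
  next
    assume "\<alpha> > 3/2 \<and> \<beta> \<le> 3/2"
    moreover define \<mu> where "\<mu> = Min {0, \<beta> + 1/2, 2 + \<beta> - \<alpha>, 5/2 - \<alpha>}"
    moreover have "\<mu> \<le> 0" "\<mu> \<le> \<beta> + 1/2" "\<mu> \<le> 2 + \<beta> - \<alpha>" "\<mu> \<le> 5/2 - \<alpha>"
      unfolding \<mu>_def by (intro Min_le'; simp)+
    ultimately show "max_lobatto_norm \<alpha> \<beta> \<in> O(\<lambda>n. real n powr (- Min {0, \<beta> + 1/2, 2 + \<beta> - \<alpha>, 5/2 - \<alpha>}))"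
      unfolding \<mu>_def[symmetric] by (intro max_lobatto_norm_bigo assms; linarith)
  next
    assume "\<alpha> > 3/2 \<and> \<beta> > 3/2"
    moreover define \<mu> where "\<mu> = Min {0, 2 + \<alpha> - \<beta>, 2 + \<beta> - \<alpha>, 5/2 - \<alpha>, 5/2 - \<beta>}"
    moreover have "\<mu> \<le> 0" "\<mu> \<le> 2 + \<alpha> - \<beta>" "\<mu> \<le> 2 + \<beta> - \<alpha>" "\<mu> \<le> 5/2 - \<alpha>" "\<mu> \<le> 5/2 - \<beta>"
      unfolding \<mu>_def by (intro Min_le'; simp)+
    ultimately show "max_lobatto_norm \<alpha> \<beta> \<in>
        O(\<lambda>n. real n powr (- Min {0, 2 + \<alpha> - \<beta>, 2 + \<beta> - \<alpha>, 5/2 - \<alpha>, 5/2 - \<beta>}))"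
      unfolding \<mu>_def[symmetric] by (intro max_lobatto_norm_bigo assms; linarith)
  }
qed

end
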